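(* For every positive integer $m$ there are a finite alphabet $\Sigma$, a sentence $\varphi_m\in\mathrm{FO}^2_m[<,\mathrm{suc}]$ and two languages $K_m,L_m\subseteq\Sigma^\star$ such that $\varphi_m$ separates $K_m$ and $L_m$, but no sentence $\psi\in\mathrm{FO}^2_{m-1}[<,\mathrm{suc}]$ separates $K_m$ and $L_m$.
   Context: Words are finite structures with universe $\{1,\dots,|w|\}$, unary predicates $Q_a$ ($a\in\Sigma$) marking positions carrying $a$, the order $<$ and the successor relation $\mathrm{suc}(z,z')\iff z'=z+1$. $\mathrm{FO}^2_n[<,\mathrm{suc}]$ is first-order logic over this signature using only the variables $x,y$ with quantifier depth at most $n$; $\mathrm{FO}^2_{m,n}[<,\mathrm{suc}]$ is the set of its formulas in which every path in the parse tree has at most $m$ blocks of alternating quantifiers, and $\mathrm{FO}^2_m[<,\mathrm{suc}]=\bigcup_{n\ge m}\mathrm{FO}^2_{m,n}[<,\mathrm{suc}]$. A formula $\varphi$ separates $K,L$ if every word of $K$ satisfies $\varphi$ and no word of $L$ does, or vice versa. *)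

theory Defs
  imports Main
begin

text \<open>Two-variable first-order logic over words, signature Q_a, <, suc (and =).
  Formulas are in negation normal form: negation only in front of atoms.\<close>

datatype var = VX | VY

datatype 'a fo2 =
    TT | FF
  | Lett 'a var | NLett 'a var
  | Less var var | NLess var var
  | Succ var var | NSucc var var
  | Eq var var | NEq var var
  | And "'a fo2" "'a fo2" | Or "'a fo2" "'a fo2"
  | Ex var "'a fo2" | All var "'a fo2"

text \<open>Words are lists; positions are 0..<length w (universe {1..|w|} shifted).\<close>
fun sat :: "'a list \<Rightarrow> (var \<Rightarrow> nat) \<Rightarrow> 'a fo2 \<Rightarrow> bool" where
  "sat w s TT = True"
| "sat w s FF = False"
| "sat w s (Lett a v) = (w ! s v = a)"
| "sat w s (NLett a v) = (\<not> (w ! s v = a))"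
| "sat w s (Less u v) = (s u < s v)"
| "sat w s (NLess u v) = (\<not> s u < s v)"
| "sat w s (Succ u v) = (s v = s u + 1)"
| "sat w s (NSucc u v) = (\<not> s v = s u + 1)"
| "sat w s (Eq u v) = (s u = s v)"
| "sat w s (NEq u v) = (s u \<noteq> s v)"
| "sat w s (And \<phi> \<psi>) = (sat w s \<phi> \<and> sat w s \<psi>)"
| "sat w s (Or \<phi> \<psi>) = (sat w s \<phi> \<or> sat w s \<psi>)"
| "sat w s (Ex v \<phi>) = (\<exists>i<length w. sat w (s(v := i)) \<phi>)"
| "sat w s (All v \<phi>) = (\<forall>i<length w. sat w (s(v := i)) \<phi>)"

fun free :: "'a fo2 \<Rightarrow> var set" where
  "free TT = {}"
| "free FF = {}"
| "free (Lett a v) = {v}"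
| "free (NLett a v) = {v}"
| "free (Less u v) = {u, v}"
| "free (NLess u v) = {u, v}"
| "free (Succ u v) = {u, v}"
| "free (NSucc u v) = {u, v}"
| "free (Eq u v) = {u, v}"
| "free (NEq u v) = {u, v}"
| "free (And \<phi> \<psi>) = free \<phi> \<union> free \<psi>"
| "free (Or \<phi> \<psi>) = free \<phi> \<union> free \<psi>"
| "free (Ex v \<phi>) = free \<phi> - {v}"
| "free (All v \<phi>) = free \<phi> - {v}"

definition sentence :: "'a fo2 \<Rightarrow> bool" where
  "sentence \<phi> \<longleftrightarrow> free \<phi> = {}"

fun letters :: "'a fo2 \<Rightarrow> 'a set" where
  "letters (Lett a v) = {a}"
| "letters (NLett a v) = {a}"
| "letters (And \<phi> \<psi>) = letters \<phi> \<union> letters \<psi>"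
| "letters (Or \<phi> \<psi>) = letters \<phi> \<union> letters \<psi>"
| "letters (Ex v \<phi>) = letters \<phi>"
| "letters (All v \<phi>) = letters \<phi>"
| "letters _ = {}"

fun qdepth :: "'a fo2 \<Rightarrow> nat" where
  "qdepth (And \<phi> \<psi>) = max (qdepth \<phi>) (qdepth \<psi>)"
| "qdepth (Or \<phi> \<psi>) = max (qdepth \<phi>) (qdepth \<psi>)"
| "qdepth (Ex v \<phi>) = Suc (qdepth \<phi>)"
| "qdepth (All v \<phi>) = Suc (qdepth \<phi>)"
| "qdepth _ = 0"

text \<open>Maximal number of blocks of alternating quantifiers along a path of the
  parse tree; the argument records the kind of the last quantifier above
  (None: none, Some True: existential, Some False: universal).\<close>
fun blk :: "bool option \<Rightarrow> 'a fo2 \<Rightarrow> nat" where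
  "blk p (And \<phi> \<psi>) = max (blk p \<phi>) (blk p \<psi>)"
| "blk p (Or \<phi> \<psi>) = max (blk p \<phi>) (blk p \<psi>)"
| "blk p (Ex v \<phi>) = (if p = Some True then 0 else 1) + blk (Some True) \<phi>"
| "blk p (All v \<phi>) = (if p = Some False then 0 else 1) + blk (Some False) \<phi>"
| "blk p _ = 0"

definition blocks :: "'a fo2 \<Rightarrow> nat" where
  "blocks \<phi> = blk None \<phi>"

definition FO2mn :: "nat \<Rightarrow> nat \<Rightarrow> 'a fo2 set" where
  "FO2mn m n = {\<phi>. blocks \<phi> \<le> m \<and> qdepth \<phi> \<le> n}"

definition FO2m :: "nat \<Rightarrow> 'a fo2 set" where
  "FO2m m = (\<Union>n\<in>{m..}. FO2mn m n)"

definition separates :: "'a fo2 \<Rightarrow> 'a list set \<Rightarrow> 'a list set \<Rightarrow> bool" where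
  "separates \<phi> K L \<longleftrightarrow>
     ((\<forall>w\<in>K. sat w (\<lambda>_. 0) \<phi>) \<and> (\<forall>w\<in>L. \<not> sat w (\<lambda>_. 0) \<phi>)) \<or>
     ((\<forall>w\<in>L. sat w (\<lambda>_. 0) \<phi>) \<and> (\<forall>w\<in>K. \<not> sat w (\<lambda>_. 0) \<phi>))"

end

theory Submission
  imports Defs
begin

text \<open>
  Words \<open>u\<close>, \<open>v\<close> that cannot be told apart with \<open>m\<close> blocks of quantifiers are inserted between
  contexts \<open>C = x s x s \<dots> x\<close> and \<open>D = y s y s \<dots> y\<close>, where \<open>s\<close> lists all letters of \<open>u\<close> and \<open>v\<close> and
  \<open>x\<close>, \<open>y\<close> are new. A single block of quantifiers of bounded depth cannot distinguish two positions
  of the inserted word that carry the same letter, so the last block is wasted and \<open>C u D\<close>, \<open>C v D\<close>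
  agree on formulas with \<open>m + 1\<close> blocks. On the other hand the inserted positions are
  those with no \<open>x\<close> at or to the right and no \<open>y\<close> at or to the left, so relativizing a separating
  formula to them costs one block. All this uses the order only; finally, spreading the letters
  out by long stretches of a filler letter makes the successor relation useless.
\<close>

section \<open>One-sided games\<close>

text \<open>A single block of quantifiers is weak because in its game Spoiler never changes the word
  he moves in. A reply then only has to keep, on either side, as much room as Spoiler's position
  has, or room enough for all remaining moves. Contexts with more periods than there are moves
  provide that room whatever is inserted between them. The sandwich thus adds one block both to what
  is indistinguishable and to what separates, and a gap of one block persists. It starts from
  \<open>1 2 1 2 ...\<close> against \<open>2 1 2 1 ...\<close>: that some 1 has no 2 before it
  takes two blocks to say. Sentences with \<open>m - 1\<close> blocks have unbounded depth, so the
  pair of words depends on the depth while the separating sentence must not; the languages collect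
  the pairs for all depths. Replies into a context ignore neighbouring positions, which is why
  successor stays out of the game until the padding.\<close>

definition agree :: "'a list \<Rightarrow> nat \<Rightarrow> 'a list \<Rightarrow> nat \<Rightarrow> bool" where
  "agree w i w' j \<longleftrightarrow> w ! i = w' ! j \<and> (i = 0 \<longleftrightarrow> j = 0) \<and>
     (Suc i = length w \<longleftrightarrow> Suc j = length w')"

definition same_order :: "nat \<Rightarrow> nat \<Rightarrow> nat \<Rightarrow> nat \<Rightarrow> bool" where
  "same_order i i' j j' \<longleftrightarrow> (i < i' \<longleftrightarrow> j < j') \<and> (i' < i \<longleftrightarrow> j' < j)"

definition same_suc_order :: "nat \<Rightarrow> nat \<Rightarrow> nat \<Rightarrow> nat \<Rightarrow> bool" where
  "same_suc_order i i' j j' \<longleftrightarrow> same_order i i' j j' \<and>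
     (i' = Suc i \<longleftrightarrow> j' = Suc j) \<and> (i = Suc i' \<longleftrightarrow> j = Suc j')"

text \<open>Spoiler moves in \<open>w\<close>; at most \<open>k\<close> times he may change to the
  other word, whereupon the two words trade places. A new position is compared by \<open>R\<close>
  only with the current one, since requantifying one of two variables leaves just the other in
  memory. The tests of \<open>agree\<close> on both ends pair position 0 with position 0, the
  default value of variables, and keep padded replies inside the word.\<close>

fun game :: "(nat \<Rightarrow> nat \<Rightarrow> nat \<Rightarrow> nat \<Rightarrow> bool) \<Rightarrow> nat \<Rightarrow> nat \<Rightarrow>
    'a list \<Rightarrow> nat \<Rightarrow> 'a list \<Rightarrow> nat \<Rightarrow> bool" where
  "game R k 0 w i w' j \<longleftrightarrow> agree w i w' j"
| "game R k (Suc n) w i w' j \<longleftrightarrow> agree w i w' j \<and>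
     (\<forall>i'<length w. \<exists>j'<length w'. R i i' j j' \<and> game R k n w i' w' j') \<and>
     (k > 0 \<longrightarrow> (\<forall>j'<length w'. \<exists>i'<length w. R i i' j j' \<and> game R (k - 1) n w' j' w i'))"

lemma game_agree: "game R k n w i w' j \<Longrightarrow> agree w i w' j"
  by (cases n) auto

lemma game_mono:
  "game R k n w i w' j \<Longrightarrow> k' \<le> k \<Longrightarrow> n' \<le> n \<Longrightarrow> game R k' n' w i w' j"
proof (induction n arbitrary: k n' k' w i w' j)
  case 0
  then show ?case by simp
next
  case (Suc n)
  show ?case
  proof (cases n')
    case 0
    then show ?thesis using Suc.prems game_agree by auto
  next
    case (Suc l)
    have l: "l \<le> n" using Suc \<open>n' \<le> Suc n\<close> by simp
    have 1: "game R k' l w i' w' j'" if "game R k n w i' w' j'" for i' j'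
      using Suc.IH that l \<open>k' \<le> k\<close> by blast
    have 2: "game R (k' - 1) l w' j' w i'" if "game R (k - 1) n w' j' w i'" for i' j'
      using Suc.IH[OF that _ l, of "k' - 1"] \<open>k' \<le> k\<close> by simp
    have "\<forall>i'<length w. \<exists>j'<length w'. R i i' j j' \<and> game R k' l w i' w' j'"
      using Suc.prems(1) 1 by (simp, blast)
    moreover have "\<forall>j'<length w'. \<exists>i'<length w. R i i' j j' \<and> game R (k' - 1) l w' j' w i'"
      if "k' > 0"
    proof -
      have "k > 0" using that \<open>k' \<le> k\<close> by simp
      then show ?thesis using Suc.prems(1) 2 by (simp, blast)
    qed
    ultimately show ?thesis
      using game_agree[OF Suc.prems(1)] Suc by simp
  qed
qed

lemma game_forth:
  "game R k (Suc n) w i w' j \<Longrightarrow> i' < length w \<Longrightarrow>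
    \<exists>j'<length w'. R i i' j j' \<and> game R k n w i' w' j'"
  by simp

lemma game_back:
  "game R (Suc k) (Suc n) w i w' j \<Longrightarrow> j' < length w' \<Longrightarrow>
    \<exists>i'<length w. R i i' j j' \<and> game R k n w' j' w i'"
  by simp

text \<open>Spoiler may change words on the spot by choosing \<open>j\<close> itself; the reply is
  then forced to be \<open>i\<close>. The reversed game remains, at the price of one move and one
  switch.\<close>

lemma game_swap:
  assumes "game R (Suc k) (Suc n) w i w' j" "j < length w'"
    and "\<And>i'. R i i' j j \<Longrightarrow> i' = i"
  shows "game R k n w' j w i"
proof -
  obtain i' where "R i i' j j" "game R k n w' j w i'" using assms(1,2) by auto
  then show ?thesis using assms(3) by blast
qed

lemma same_order_refl: "same_order i i' j j \<Longrightarrow> i' = i"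
  by (auto simp: same_order_def)

lemma same_suc_order_refl: "same_suc_order i i' j j \<Longrightarrow> i' = i"
  by (auto simp: same_suc_order_def same_order_def)

lemma same_suc_order_flip: "same_suc_order i i' j j' \<Longrightarrow> same_suc_order i' i j' j"
  unfolding same_suc_order_def same_order_def by blast

lemma same_suc_order_swap: "same_suc_order i i' j j' \<Longrightarrow> same_suc_order j j' i i'"
  unfolding same_suc_order_def same_order_def by blast

section \<open>From games to two-variable formulas\<close>

fun other :: "var \<Rightarrow> var" where
  "other VX = VY"
| "other VY = VX"

lemma other_neq[simp]: "other v \<noteq> v" "v \<noteq> other v"
  by (cases v; simp)+

lemma var_cases: "u = v \<or> u = other v"
  by (cases u; cases v; simp)

text \<open>Both variables carry a game: a quantifier on one of them drops its position and play
  goes on from the position of the other.\<close>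

definition matched ::
  "nat \<Rightarrow> nat \<Rightarrow> 'a list \<Rightarrow> (var \<Rightarrow> nat) \<Rightarrow> 'a list \<Rightarrow> (var \<Rightarrow> nat) \<Rightarrow> bool" where
  "matched k n w s w' s' \<longleftrightarrow>
     (\<forall>v. s v < length w \<and> s' v < length w' \<and> game same_suc_order k n w (s v) w' (s' v)) \<and>
     (\<forall>u v. same_suc_order (s u) (s v) (s' u) (s' v))"

lemma matched_update:
  assumes m: "matched k n w s w' s'" and le: "k' \<le> k" "n' \<le> n"
    and i: "i < length w" "j < length w'" "same_suc_order (s (other v)) i (s' (other v)) j"
    and g: "game same_suc_order k' n' w i w' j"
  shows "matched k' n' w (s(v := i)) w' (s'(v := j))"
proof -
  have "same_suc_order i (s (other v)) j (s' (other v))"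
    using i(3) by (rule same_suc_order_flip)
  moreover have "same_suc_order i i j j"
    by (simp add: same_suc_order_def same_order_def)
  ultimately have "same_suc_order ((s(v := i)) x) ((s(v := i)) y) ((s'(v := j)) x) ((s'(v := j)) y)"
    for x y
    using var_cases[of x v] var_cases[of y v] i(3) m unfolding matched_def
    by (metis fun_upd_other fun_upd_same other_neq(1))
  moreover have "game same_suc_order k' n' w (s x) w' (s' x)" for x
    using m le game_mono unfolding matched_def by blast
  ultimately show ?thesis
    using m i(1,2) g unfolding matched_def by simp
qed

lemma matched_swap:
  assumes "matched (Suc k) (Suc n) w s w' s'"
  shows "matched k n w' s' w s"
  unfolding matched_def
proof (intro conjI allI)
  fix v
  show "s' v < length w'" "s v < length w" using assms by (auto simp: matched_def)
  show "game same_suc_order k n w' (s' v) w (s v)"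
    using assms game_swap same_suc_order_refl unfolding matched_def by metis
next
  fix u v
  show "same_suc_order (s' u) (s' v) (s u) (s v)"
    using assms same_suc_order_swap unfolding matched_def by blast
qed

lemma matched_forth:
  assumes m: "matched k (Suc n) w s w' s'" and i: "i < length w"
  obtains j where "j < length w'" "matched k n w (s(v := i)) w' (s'(v := j))"
proof -
  have "game same_suc_order k (Suc n) w (s (other v)) w' (s' (other v))"
    using m by (simp add: matched_def)
  then obtain j where j: "j < length w'" "same_suc_order (s (other v)) i (s' (other v)) j"
      "game same_suc_order k n w i w' j"
    using i by auto
  show thesis
    using that[OF j(1)] matched_update[OF m _ _ i j(1,2) j(3)] by simp
qed

lemma matched_back:
  assumes m: "matched (Suc k) (Suc n) w s w' s'" and j: "j < length w'"
  obtains i where "i < length w" "matched k n w' (s'(v := j)) w (s(v := i))"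
proof -
  have "game same_suc_order (Suc k) (Suc n) w (s (other v)) w' (s' (other v))"
    using m by (simp add: matched_def)
  then obtain i where i: "i < length w" "same_suc_order (s (other v)) i (s' (other v)) j"
      "game same_suc_order k n w' j w i"
    using j by auto
  have "same_suc_order (s' (other v)) j (s (other v)) i"
    using i(2) by (rule same_suc_order_swap)
  then show thesis
    using that[OF i(1)] matched_update[OF matched_swap[OF m] _ _ j i(1) _ i(3)] by simp
qed

lemma matched_atoms:
  assumes "matched k n w s w' s'"
  shows "w ! s v = w' ! s' v" "s u < s v \<longleftrightarrow> s' u < s' v" "s u = s v \<longleftrightarrow> s' u = s' v"
    "s v = Suc (s u) \<longleftrightarrow> s' v = Suc (s' u)"
proof -
  have "agree w (s v) w' (s' v)"
    using assms game_agree unfolding matched_def by blast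
  then show "w ! s v = w' ! s' v" by (simp add: agree_def)
  have "same_suc_order (s u) (s v) (s' u) (s' v)" using assms by (simp add: matched_def)
  then show "s u < s v \<longleftrightarrow> s' u < s' v" "s u = s v \<longleftrightarrow> s' u = s' v"
    "s v = Suc (s u) \<longleftrightarrow> s' v = Suc (s' u)"
    unfolding same_suc_order_def same_order_def by (blast, metis less_linear less_irrefl, blast)
qed

text \<open>An existential witness is a Spoiler move in \<open>w\<close>, a universal instance in
  \<open>w'\<close> is a move in the other word. Hence staying with one kind of quantifier costs no
  switch and each alternation costs one. The two claims are dual, with the words exchanged, and feed
  each other at alternations.\<close>

lemma game_sound:
  assumes "matched k n w s w' s'" "qdepth \<phi> \<le> n"
  shows "blk (Some True) \<phi> \<le> k \<Longrightarrow> sat w s \<phi> \<Longrightarrow> sat w' s' \<phi>"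
    and "blk (Some False) \<phi> \<le> k \<Longrightarrow> sat w' s' \<phi> \<Longrightarrow> sat w s \<phi>"
  using assms
proof (induction \<phi> arbitrary: k n w s w' s')
  case (Ex v \<phi>)
  {
    case 1
    then obtain n' where n: "n = Suc n'" by (cases n) auto
    obtain i where i: "i < length w" "sat w (s(v := i)) \<phi>" using 1 by auto
    obtain j where j: "j < length w'" "matched k n' w (s(v := i)) w' (s'(v := j))"
      using matched_forth 1(3) i(1) n by blast
    have "sat w' (s'(v := j)) \<phi>" by (rule Ex.IH(1)[OF _ i(2) j(2)]) (use 1 n in simp_all)
    then show ?case using j(1) by auto
  next
    case 2
    then obtain n' where n: "n = Suc n'" by (cases n) auto
    obtain k' where k: "k = Suc k'" using 2 by (cases k) auto
    obtain j where j: "j < length w'" "sat w' (s'(v := j)) \<phi>" using 2 by auto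
    obtain i where i: "i < length w" "matched k' n' w' (s'(v := j)) w (s(v := i))"
      using matched_back 2(3) j(1) n k by blast
    have "sat w (s(v := i)) \<phi>"
      by (rule Ex.IH(1)[OF _ j(2) i(2)]) (use 2 n k in simp_all)
    then show ?case using i(1) by auto
  }
next
  case (All v \<phi>)
  {
    case 1
    then obtain n' where n: "n = Suc n'" by (cases n) auto
    obtain k' where k: "k = Suc k'" using 1 by (cases k) auto
    have "sat w' (s'(v := j)) \<phi>" if j: "j < length w'" for j
    proof -
      obtain i where i: "i < length w" "matched k' n' w' (s'(v := j)) w (s(v := i))"
        using matched_back 1(3) j n k by blast
      have "sat w (s(v := i)) \<phi>" using 1 i(1) by simp
      then show ?thesis by (rule All.IH(2)[OF _ _ i(2), rotated]) (use 1 n k in simp_all)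
    qed
    then show ?case by simp
  next
    case 2
    then obtain n' where n: "n = Suc n'" by (cases n) auto
    have "sat w (s(v := i)) \<phi>" if i: "i < length w" for i
    proof -
      obtain j where j: "j < length w'" "matched k n' w (s(v := i)) w' (s'(v := j))"
        using matched_forth 2(3) i n by blast
      have "sat w' (s'(v := j)) \<phi>" using 2 j(1) by simp
      then show ?thesis by (rule All.IH(2)[OF _ _ j(2), rotated]) (use 2 n in simp_all)
    qed
    then show ?case by simp
  }
next
  case (And \<phi> \<psi>)
  {
    case 1 then show ?case using And.IH(1,3)[of k w s n w' s'] by simp
  next
    case 2 then show ?case using And.IH(2,4)[of k w' s' n w s] by simp
  }
next
  case (Or \<phi> \<psi>)
  {
    case 1 then show ?case using Or.IH(1,3)[of k w s n w' s'] by auto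
  next
    case 2 then show ?case using Or.IH(2,4)[of k w' s' n w s] by auto
  }
qed (simp_all, (metis matched_atoms)+)

text \<open>The outermost block is free: games in both directions are available, and the one in
  which Spoiler starts in the suitable word is used. So \<open>k\<close> switches cover
  \<open>k + 1\<close> blocks.\<close>

lemma game_sound_blocks:
  assumes "matched k n w s w' s'" "matched k n w' s' w s" "qdepth \<phi> \<le> n"
    "blocks \<phi> \<le> Suc k"
  shows "sat w s \<phi> \<longleftrightarrow> sat w' s' \<phi>"
  using assms(3,4) unfolding blocks_def
proof (induction \<phi>)
  case (Ex v \<phi>)
  have "blk (Some True) (Ex v \<phi>) \<le> k" using Ex by simp
  then show ?case using game_sound(1) assms(1,2) Ex.prems(1) by metis
next
  case (All v \<phi>)
  have "blk (Some False) (All v \<phi>) \<le> k" using All by simp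
  then show ?case using game_sound(2) assms(1,2) All.prems(1) by metis
qed (simp_all, (metis matched_atoms[OF assms(1)])+)


text \<open>Spoiler opens in either word and then has \<open>k\<close> switches: the counterpart of
  \<open>k + 1\<close> blocks, over the order alone.\<close>

definition game_equiv :: "nat \<Rightarrow> nat \<Rightarrow> 'a list \<Rightarrow> 'a list \<Rightarrow> bool" where
  "game_equiv k n w w' \<longleftrightarrow>
     (\<forall>i<length w. \<exists>j<length w'. game same_order k n w i w' j) \<and>
     (\<forall>j<length w'. \<exists>i<length w. game same_order k n w' j w i)"

lemma game_equiv_sym: "game_equiv k n w w' \<Longrightarrow> game_equiv k n w' w"
  by (auto simp: game_equiv_def)

lemma game_equivD:
  "game_equiv k n w w' \<Longrightarrow> i < length w \<Longrightarrow> \<exists>j<length w'. game same_order k n w i w' j"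
  by (drule game_equiv_def[THEN iffD1, THEN conjunct1]) simp

lemma game_equivI:
  assumes "\<And>i. i < length w \<Longrightarrow> \<exists>j<length w'. game same_order k n w i w' j"
    and "\<And>j. j < length w' \<Longrightarrow> \<exists>i<length w. game same_order k n w' j w i"
  shows "game_equiv k n w w'"
  unfolding game_equiv_def using assms by (intro conjI allI impI)

lemma same_orderI:
  "i < i' \<Longrightarrow> j < j' \<Longrightarrow> same_order i i' j j'"
  "i' < i \<Longrightarrow> j' < j \<Longrightarrow> same_order i i' j j'"
  "same_order i i j j"
  by (auto simp: same_order_def)

lemma same_order_swap: "same_order i i' j j' \<longleftrightarrow> same_order j j' i i'"
  unfolding same_order_def by blast

lemma game_equiv_mono:
  assumes "game_equiv k n w w'" "k' \<le> k" "n' \<le> n"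
  shows "game_equiv k' n' w w'"
proof -
  have "\<exists>j<length v. game same_order k' n' u i v j"
    if eq: "game_equiv k n u v" and i: "i < length u" for u v :: "'a list" and i
    using game_equivD[OF eq i] game_mono[OF _ assms(2,3)] by blast
  from this[OF assms(1)] this[OF game_equiv_sym[OF assms(1)]] show ?thesis
    by (rule game_equivI)
qed

lemma game_equiv_set:
  assumes "game_equiv k n w w'"
  shows "set w = set w'"
proof -
  have *: "set u \<subseteq> set u'" if eq: "game_equiv k n u u'" for u u' :: "'a list"
  proof
    fix a assume "a \<in> set u"
    then obtain i where i: "i < length u" "u ! i = a" by (meson in_set_conv_nth)
    obtain j where "j < length u'" "game same_order k n u i u' j"
      using game_equivD[OF eq i(1)] by blast
    then have "u' ! j = a" using game_agree i(2) unfolding agree_def by metis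
    then show "a \<in> set u'" using \<open>j < length u'\<close> nth_mem by blast
  qed
  show ?thesis using *[OF assms] *[OF game_equiv_sym[OF assms]] by (rule equalityI)
qed

section \<open>Sandwiching words between rich contexts\<close>

locale rich_context =
  fixes C D :: "'a list" and P :: nat
  assumes C_rich: "p + P \<le> length C \<Longrightarrow> b \<in> set C \<Longrightarrow> \<exists>q\<ge>p. q < p + P \<and> C ! q = b"
    and D_rich: "p + P \<le> length D \<Longrightarrow> b \<in> set D \<Longrightarrow> \<exists>q\<ge>p. q < p + P \<and> D ! q = b"
    and C_nonempty: "C \<noteq> []" and D_nonempty: "D \<noteq> []"
begin

section \<open>Aligning words that differ in the inserted part\<close>

abbreviation "c \<equiv> length C"
abbreviation "T \<equiv> c + 1 + length D"
abbreviation "word u \<equiv> C @ u @ D"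

text \<open>Collapses the inserted word to the single point \<open>c\<close>, so that positions of
  \<open>C @ u @ D\<close> and \<open>C @ v @ D\<close> become comparable although \<open>u\<close>
  and \<open>v\<close> may differ in length; \<open>T\<close> points are left.\<close>

definition al :: "'a list \<Rightarrow> nat \<Rightarrow> nat" where
  "al u p = (if p < c then p else if p < c + length u then c else p - length u + 1)"

lemma al_eq_c: "u \<noteq> [] \<Longrightarrow> al u p = c \<longleftrightarrow> c \<le> p \<and> p < c + length u"
  by (auto simp: al_def)

lemma al_less_T: "p < length (word u) \<Longrightarrow> al u p < T"
  by (auto simp: al_def)

lemma al_mono: "p \<le> q \<Longrightarrow> al u p \<le> al u q"
  by (auto simp: al_def)

lemma al_less_imp: "al u p < al u q \<Longrightarrow> p < q"
  using al_mono[of q p u] by (meson leD not_le_imp_less)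

lemma al_inj: "u \<noteq> [] \<Longrightarrow> al u p = al u q \<Longrightarrow> al u p \<noteq> c \<Longrightarrow> p = q"
  by (auto simp: al_def split: if_splits)

lemma al_inj_less: "u \<noteq> [] \<Longrightarrow> p < q \<Longrightarrow> al u p < al u q \<or> al u p = c \<and> al u q = c"
  using al_inj[of u p q] al_mono[of p q u] by linarith

lemma al_eq_0: "u \<noteq> [] \<Longrightarrow> al u p = 0 \<longleftrightarrow> p = 0"
  unfolding al_def using C_nonempty by (cases C) auto

lemma al_eq_last: "u \<noteq> [] \<Longrightarrow> Suc (al u p) = T \<longleftrightarrow> Suc p = length (word u)"
  using D_nonempty by (cases D; cases u) (auto simp: al_def)

lemma nth_left: "al u p < c \<Longrightarrow> u \<noteq> [] \<Longrightarrow> word u ! p = C ! al u p"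
  by (auto simp: al_def nth_append split: if_splits)

lemma nth_right: "c < al u p \<Longrightarrow> u \<noteq> [] \<Longrightarrow> word u ! p = D ! (al u p - c - 1)"
  by (auto simp: al_def nth_append add.commute split: if_splits)

lemma nth_mid: "al u p = c \<Longrightarrow> u \<noteq> [] \<Longrightarrow> word u ! p = u ! (p - c)"
  by (auto simp: al_def nth_append split: if_splits)

lemma al_surj:
  assumes "u \<noteq> []" "\<alpha> < T"
  obtains p where "p < length (word u)" "al u p = \<alpha>"
proof (cases "\<alpha> \<le> c")
  case True
  then have "\<alpha> < length (word u)" "al u \<alpha> = \<alpha>"
    using assms by (cases u; auto simp: al_def)+
  then show ?thesis using that by blast
next
  case False
  then have "\<alpha> + length u - 1 < length (word u)" "al u (\<alpha> + length u - 1) = \<alpha>"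
    using assms by (auto simp: al_def)
  then show ?thesis using that by blast
qed

lemma nth_eq_of_al:
  assumes "u \<noteq> []" "v \<noteq> []" "al u p = al v q" "al u p \<noteq> c"
  shows "word u ! p = word v ! q"
  using assms nth_left[of u p] nth_left[of v q] nth_right[of u p] nth_right[of v q]
  by (metis linorder_neqE_nat)

lemma agree_of_al:
  assumes "u \<noteq> []" "v \<noteq> []" "(al u p = 0) = (al v q = 0)" "(Suc (al u p) = T) = (Suc (al v q) = T)"
    "word u ! p = word v ! q"
  shows "agree (word u) p (word v) q"
  using assms al_eq_0 al_eq_last unfolding agree_def by metis

text \<open>Position \<open>i\<close> dominates position \<open>j\<close> (both given by their aligned values) if everything
  that can be seen in \<open>n\<close> moves from \<open>j\<close> can also be seen from \<open>i\<close>; the inserted word counts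
  as one point, because all its letters occur in both contexts.\<close>

definition dom_right :: "nat \<Rightarrow> nat \<Rightarrow> nat \<Rightarrow> bool" where
  "dom_right n i j \<longleftrightarrow> i \<le> j \<or> c \<le> j \<and> i + n * P + 1 < T \<or> i + n * P + 1 < c"

text \<open>As in \<open>dom_right\<close>, \<open>n * P\<close> reserves one period per remaining
  move. If \<open>j\<close> is not right of the inserted word, everything to its left is a letter of
  \<open>C\<close>, so room in \<open>C\<close> is enough; the last alternative keeps room inside
  \<open>D\<close>. The strict inequality here and the \<open>+ 1\<close> in
  \<open>dom_right\<close> keep replies off the first and last position, which \<open>agree\<close>
  can see.\<close>

definition dom_left :: "nat \<Rightarrow> nat \<Rightarrow> nat \<Rightarrow> bool" where
  "dom_left n i j \<longleftrightarrow> j \<le> i \<or> j \<le> c \<and> n * P < i \<or> c + n * P < i"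

definition dom :: "nat \<Rightarrow> 'a list \<Rightarrow> nat \<Rightarrow> 'a list \<Rightarrow> nat \<Rightarrow> bool" where
  "dom n v j u i \<longleftrightarrow> word v ! j = word u ! i \<and> (al v j = 0 \<longleftrightarrow> al u i = 0) \<and>
     (Suc (al v j) = T \<longleftrightarrow> Suc (al u i) = T) \<and>
     dom_right n (al u i) (al v j) \<and> dom_left n (al u i) (al v j)"

lemma dom_of_al_eq: "al v j = al u i \<Longrightarrow> word v ! j = word u ! i \<Longrightarrow> dom n v j u i"
  by (simp add: dom_def dom_right_def dom_left_def)

lemma dom_Suc: "dom (Suc n) v j u i \<Longrightarrow> dom n v j u i"
  by (auto simp: dom_def dom_right_def dom_left_def)

lemma exact_reply:
  assumes "u \<noteq> []" "v \<noteq> []" "set u = set v" "j < length (word v)"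
  obtains i where "i < length (word u)" "al u i = al v j" "word u ! i = word v ! j"
proof (cases "al v j = c")
  case False
  obtain i where "i < length (word u)" "al u i = al v j"
    using al_surj[OF assms(1) al_less_T[OF assms(4)]] by metis
  then show ?thesis using that nth_eq_of_al[OF assms(1,2)] False by metis
next
  case True
  then have "j - c < length v" "word v ! j = v ! (j - c)"
    using al_eq_c[of v j] nth_mid[of v j] assms(2) by auto
  then obtain q where q: "q < length u" "u ! q = word v ! j"
    using assms(3) by (metis in_set_conv_nth)
  then have "al u (c + q) = c" using al_eq_c[of u] assms(1) by simp
  then show ?thesis using that[of "c + q"] q True nth_mid[of u "c + q"] assms(1) by simp
qed

lemma letter_left:
  assumes "al v j \<le> c" "v \<noteq> []" "set v \<subseteq> set C"
  shows "word v ! j \<in> set C"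
proof (cases "al v j = c")
  case True
  then have "j - c < length v" using al_eq_c[of v j] assms(2) by auto
  then show ?thesis using nth_mid[OF True assms(2)] assms(3) by auto
next
  case False
  then show ?thesis using nth_left[of v j] assms by simp
qed

lemma letter_right:
  assumes "c \<le> al v j" "v \<noteq> []" "set v \<subseteq> set D" "j < length (word v)"
  shows "word v ! j \<in> set D"
proof (cases "al v j = c")
  case True
  then have "j - c < length v" using al_eq_c[of v j] assms(2) by auto
  then show ?thesis using nth_mid[OF True assms(2)] assms(3) by auto
next
  case False
  then show ?thesis using nth_right[of v j] assms al_less_T[OF assms(4)] by simp
qed

lemma C_reply:
  assumes "u \<noteq> []" "p + P \<le> c" "b \<in> set C"
  obtains i where "i < length (word u)" "p \<le> al u i" "al u i < p + P" "word u ! i = b"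
proof -
  obtain q where q: "q \<ge> p" "q < p + P" "C ! q = b" using C_rich assms(2,3) by blast
  then have "al u q = q" "q < length (word u)" using assms(2) by (auto simp: al_def)
  then show ?thesis using that[of q] q nth_left[of u q] assms by simp
qed

lemma D_reply:
  assumes "u \<noteq> []" "c < p" "p + P \<le> T" "b \<in> set D"
  obtains i where "i < length (word u)" "p \<le> al u i" "al u i < p + P" "word u ! i = b"
proof -
  obtain q where q: "q \<ge> p - c - 1" "q < p - c - 1 + P" "D ! q = b"
    using D_rich[of "p - c - 1" b] assms(2-4) by fastforce
  have "c + 1 + q < T" using q(2) assms(2,3) by linarith
  then obtain i where i: "i < length (word u)" "al u i = c + 1 + q"
    using al_surj[OF assms(1)] by blast
  then show ?thesis using that[of i] q nth_right[of u i] assms by simp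
qed

text \<open>If \<open>j'\<close> lies beyond \<open>i\<close> after alignment, it is simply copied.
  Otherwise its letter recurs within the next period to the right of \<open>i\<close>, and the
  period used up is paid for by the passage from \<open>Suc n\<close> to \<open>n\<close>.\<close>

lemma dom_move_right:
  assumes d: "dom (Suc n) v j u i" and ne: "u \<noteq> []" "v \<noteq> []"
    and sub: "set u = set v" "set v \<subseteq> set C" "set v \<subseteq> set D"
    and len: "Suc n * P + 1 < c" "Suc n * P + 1 < length D"
    and j: "j < j'" "j' < length (word v)" and i: "i < length (word u)"
  shows "\<exists>i'<length (word u). i < i' \<and> dom n v j' u i'"
proof (cases "al u i < al v j'")
  case True
  obtain i' where "i' < length (word u)" "al u i' = al v j'" "word u ! i' = word v ! j'"
    using exact_reply[OF ne sub(1) j(2)] by metis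
  then show ?thesis using True al_less_imp[of u i i'] dom_of_al_eq by metis
next
  case False
  let ?a = "al u i" and ?b = "al v j" and ?b' = "al v j'"
  have bb: "?b \<le> ?b'" using al_mono j(1) by simp
  have pos: "?b' \<noteq> 0" using al_eq_0[OF ne(2)] j(1) by simp
  have fin: ?thesis if i': "i' < length (word u)" "Suc ?a \<le> al u i'" "word u ! i' = word v ! j'"
    and r: "c \<le> ?b' \<and> al u i' + n * P + 1 < T \<or> al u i' + n * P + 1 < c" for i'
  proof -
    have "i < i'" using i'(2) al_less_imp[of u i i'] by simp
    moreover have "dom n v j' u i'"
      using i' r False pos by (auto simp: dom_def dom_right_def dom_left_def)
    ultimately show ?thesis using i'(1) by blast
  qed
  consider "?a \<le> ?b" | "c \<le> ?b" "?a + Suc n * P + 1 < T" | "?a + Suc n * P + 1 < c"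
    using d by (auto simp: dom_def dom_right_def)
  then show ?thesis
  proof cases
    case 1
    \<comment> \<open>All aligned values coincide, and only the inserted word has two positions with
      one value. Since \<open>i\<close> may be the last position of \<open>u\<close>, the reply has
      to come from \<open>D\<close>; this is where the letters of \<open>v\<close> must occur in the
      context.\<close>
    then have e: "?a = c" "?b' = c"
      using False bb al_inj_less[OF ne(2) j(1)] by auto
    then have "word v ! j' \<in> set D" using letter_right ne sub j by simp
    then obtain i' where "i' < length (word u)" "Suc c \<le> al u i'" "al u i' < Suc c + P"
        "word u ! i' = word v ! j'"
      using D_reply[OF ne(1), of "Suc c"] len by auto
    then show ?thesis using fin[of i'] e len by simp
  next
    case 2
    then have "word v ! j' \<in> set D" using letter_right ne sub j bb by simp
    then obtain i' where "i' < length (word u)" "Suc ?a \<le> al u i'" "al u i' < Suc ?a + P"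
        "word u ! i' = word v ! j'"
      using D_reply[OF ne(1), of "Suc ?a"] 2 False bb by auto
    then show ?thesis using fin[of i'] 2 bb by simp
  next
    case 3
    then have "word v ! j' \<in> set C" using letter_left ne sub False by simp
    then obtain i' where "i' < length (word u)" "Suc ?a \<le> al u i'" "al u i' < Suc ?a + P"
        "word u ! i' = word v ! j'"
      using C_reply[OF ne(1), of "Suc ?a"] 3 by auto
    then show ?thesis using fin[of i'] 3 by simp
  qed
qed

lemma dom_move_left:
  assumes d: "dom (Suc n) v j u i" and ne: "u \<noteq> []" "v \<noteq> []"
    and sub: "set u = set v" "set v \<subseteq> set C" "set v \<subseteq> set D"
    and len: "Suc n * P + 1 < c" "Suc n * P + 1 < length D"
    and j: "j' < j" "j < length (word v)" and i: "i < length (word u)"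
  shows "\<exists>i'<length (word u). i' < i \<and> dom n v j' u i'"
proof (cases "al v j' < al u i")
  case True
  have "j' < length (word v)" using j by simp
  then obtain i' where "i' < length (word u)" "al u i' = al v j'" "word u ! i' = word v ! j'"
    using exact_reply[OF ne sub(1)] by metis
  then show ?thesis using True al_less_imp[of u i' i] dom_of_al_eq by metis
next
  case False
  let ?a = "al u i" and ?b = "al v j" and ?b' = "al v j'"
  have bb: "?b' \<le> ?b" using al_mono j(1) by simp
  have j': "j' < length (word v)" using j by simp
  have pos: "Suc ?b' \<noteq> T" using al_eq_last[OF ne(2), of j'] j by simp
  have fin: ?thesis if i': "i' < length (word u)" "al u i' < ?a" "word u ! i' = word v ! j'"
    and r: "?b' \<le> c \<and> n * P < al u i' \<or> c + n * P < al u i'" for i'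
  proof -
    have "i' < i" using i'(2) al_less_imp[of u i' i] by simp
    moreover have "dom n v j' u i'"
      using i' r False pos al_less_T[OF i] by (auto simp: dom_def dom_right_def dom_left_def)
    ultimately show ?thesis using i'(1) by blast
  qed
  consider "?b \<le> ?a" | "?b \<le> c" "Suc n * P < ?a" | "c + Suc n * P < ?a"
    using d by (auto simp: dom_def dom_left_def)
  then show ?thesis
  proof cases
    case 1
    then have e: "?a = c" "?b' = c"
      using False bb al_inj_less[OF ne(2) j(1)] by auto
    then have "word v ! j' \<in> set C" using letter_left ne sub j by simp
    then obtain i' where "i' < length (word u)" "c - P \<le> al u i'" "al u i' < c - P + P"
        "word u ! i' = word v ! j'"
      using C_reply[OF ne(1), of "c - P"] len by auto
    then show ?thesis using fin[of i'] e len by simp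
  next
    case 2
    then have "word v ! j' \<in> set C" using letter_left ne sub j bb by simp
    then obtain i' where i': "i' < length (word u)" "?a - P \<le> al u i'" "al u i' < ?a - P + P"
        "word u ! i' = word v ! j'"
      using C_reply[OF ne(1), of "?a - P"] 2 False bb by auto
    moreover have "n * P < al u i'" using i'(2) 2(2) by simp
    ultimately show ?thesis using fin[of i'] 2 bb by simp
  next
    case 3
    then have "word v ! j' \<in> set D" using letter_right ne sub False j' by simp
    moreover have "c < ?a - P" "?a - P + P = ?a" using 3 by auto
    ultimately obtain i' where i': "i' < length (word u)" "?a - P \<le> al u i'" "al u i' < ?a"
        "word u ! i' = word v ! j'"
      using D_reply[OF ne(1), of "?a - P"] al_less_T[OF i] by (metis less_imp_le)
    moreover have "c + n * P < al u i'" using i'(2) 3 by simp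
    ultimately show ?thesis using fin[of i'] by simp
  qed
qed

text \<open>Without switches only room matters; \<open>u\<close> and \<open>v\<close> enter merely
  through their common set of letters.\<close>

lemma game_of_dom:
  assumes "u \<noteq> []" "v \<noteq> []" "set u = set v" "set v \<subseteq> set C" "set v \<subseteq> set D"
    and "Suc n * P + 1 < c" "Suc n * P + 1 < length D"
    and "dom n v j u i" "j < length (word v)" "i < length (word u)"
  shows "game same_order 0 n (word v) j (word u) i"
  using assms(6-)
proof (induction n arbitrary: i j)
  case 0
  then show ?case using assms(1,2) by (simp add: dom_def agree_of_al)
next
  case (Suc n)
  have len: "Suc n * P + 1 < c" "Suc n * P + 1 < length D" using Suc.prems by auto
  note IH = Suc.IH[OF len]
  have "\<exists>i'<length (word u). same_order j j' i i' \<and> game same_order 0 n (word v) j' (word u) i'"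
    if j': "j' < length (word v)" for j'
  proof -
    consider "j < j'" | "j' = j" | "j' < j" by linarith
    then show ?thesis
    proof cases
      case 1
      obtain i' where "i' < length (word u)" "i < i'" "dom n v j' u i'"
        using dom_move_right[OF Suc.prems(3) assms(1-5) len 1 j' Suc.prems(5)] by blast
      then show ?thesis using IH[of j' i'] j' 1 same_orderI(1) by blast
    next
      case 2
      then show ?thesis using IH[of j i] Suc.prems(3-5) dom_Suc same_orderI(3) by blast
    next
      case 3
      obtain i' where "i' < length (word u)" "i' < i" "dom n v j' u i'"
        using dom_move_left[OF Suc.prems(3) assms(1-5) len 3 Suc.prems(4,5)] by blast
      then show ?thesis using IH[of j' i'] j' 3 same_orderI(2) by blast
    qed
  qed
  moreover have "agree (word v) j (word u) i"
    using Suc.prems(3) assms(1,2) by (intro agree_of_al) (auto simp: dom_def)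
  ultimately show ?case by simp
qed


section \<open>Playing an inner game between the contexts\<close>

lemma same_order_al:
  assumes "al u i = al v j" "al u i' = al v j'" "u \<noteq> []" "v \<noteq> []"
    and "al u i = c \<Longrightarrow> al u i' = c \<Longrightarrow> same_order (i - c) (i' - c) (j - c) (j' - c)"
  shows "same_order i i' j j'"
proof (cases "al u i = c \<and> al u i' = c")
  case True
  then have "c \<le> i" "c \<le> i'" "c \<le> j" "c \<le> j'"
    using al_eq_c[OF assms(3), of i] al_eq_c[OF assms(3), of i'] al_eq_c[OF assms(4), of j]
      al_eq_c[OF assms(4), of j'] assms(1,2) by auto
  then show ?thesis
    using assms(5) True unfolding same_order_def by (simp only: less_diff_iff simp_thms)
next
  case False
  have *: "p < q \<longleftrightarrow> al w p < al w q" if "w \<noteq> []" "\<not> (al w p = c \<and> al w q = c)" for p q w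
    using al_inj_less[OF that(1), of p q] al_less_imp[of w p q] that(2) by blast
  have "\<not> (al v j = c \<and> al v j' = c)" using False assms(1,2) by simp
  then show ?thesis
    using False *[OF assms(3), of i i'] *[OF assms(3), of i' i] *[OF assms(4), of j j']
      *[OF assms(4), of j' j]
    unfolding same_order_def assms(1,2) by blast
qed

lemma mid_position:
  assumes "u \<noteq> []" "a < length u"
  shows "c + a < length (word u)" "al u (c + a) = c" "word u ! (c + a) = u ! a"
  using assms by (auto simp: al_def nth_append)

text \<open>The invariant while switches remain: copy the aligned position in the contexts, follow a
  won game with \<open>k\<close> switches inside the inserted word.\<close>

definition linked :: "nat \<Rightarrow> nat \<Rightarrow> 'a list \<Rightarrow> nat \<Rightarrow> 'a list \<Rightarrow> nat \<Rightarrow> bool" where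
  "linked k n u i v j \<longleftrightarrow> i < length (word u) \<and> j < length (word v) \<and> al u i = al v j \<and>
     (al u i = c \<longrightarrow> game same_order k n u (i - c) v (j - c))"

lemma linked_agree:
  assumes "linked k n u i v j" "u \<noteq> []" "v \<noteq> []"
  shows "agree (word u) i (word v) j"
proof -
  have al: "al u i = al v j" using assms(1) unfolding linked_def by blast
  have "word u ! i = word v ! j"
  proof (cases "al u i = c")
    case True
    then have "agree u (i - c) v (j - c)"
      using assms(1) game_agree unfolding linked_def by blast
    then have "u ! (i - c) = v ! (j - c)" unfolding agree_def by blast
    moreover have "al v j = c" using True al by simp
    ultimately show ?thesis using nth_mid[OF True assms(2)] nth_mid[OF _ assms(3)] by metis
  next
    case False
    then show ?thesis using nth_eq_of_al[OF assms(2,3) al] by blast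
  qed
  then show ?thesis using agree_of_al[OF assms(2,3)] al by metis
qed

lemma linked_reply:
  assumes "linked k n u i v j" "u \<noteq> []" "v \<noteq> []" "i' < length (word u)"
    and mid: "\<And>a'. a' < length u \<Longrightarrow> \<exists>b'<length v. game same_order k' n' u a' v b'"
    and same: "\<And>a'. al u i = c \<Longrightarrow> a' < length u \<Longrightarrow>
      \<exists>b'<length v. same_order (i - c) a' (j - c) b' \<and> game same_order k' n' u a' v b'"
  obtains j' where "linked k' n' u i' v j'" "same_order i i' j j'"
proof (cases "al u i' = c")
  case False
  obtain j' where "j' < length (word v)" "al v j' = al u i'"
    using al_surj[OF assms(3) al_less_T[OF assms(4)]] by metis
  moreover have "al u i = al v j" using assms(1) unfolding linked_def by blast
  ultimately have "linked k' n' u i' v j'" "same_order i i' j j'"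
    using False assms(2-4) same_order_al[of u i v j i' j'] unfolding linked_def by simp_all
  then show ?thesis by (rule that)
next
  case True
  then have a: "i' - c < length u" "c \<le> i'" using al_eq_c[OF assms(2), of i'] by auto
  obtain b where b: "b < length v" "game same_order k' n' u (i' - c) v b"
      "al u i = c \<Longrightarrow> same_order (i - c) (i' - c) (j - c) b"
  proof (cases "al u i = c")
    case True
    then show ?thesis using same[OF _ a(1)] that by blast
  next
    case False
    then show ?thesis using mid[OF a(1)] that by blast
  qed
  have "linked k' n' u i' v (c + b)"
    using mid_position(1,2)[OF assms(3) b(1)] True b(2) assms(4) unfolding linked_def by simp
  moreover have "same_order i i' j (c + b)"
  proof (rule same_order_al[OF _ _ assms(2,3)])
    show "al u i = al v j" using assms(1) unfolding linked_def by blast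
    show "al u i' = al v (c + b)" using mid_position(2)[OF assms(3) b(1)] True by simp
    show "same_order (i - c) (i' - c) (j - c) (c + b - c)" if "al u i = c"
      using b(3)[OF that] by simp
  qed
  ultimately show ?thesis by (rule that)
qed

text \<open>Each outer switch is matched by an inner one until the inner game has none left. The one
  further switch is the gain: after it no switch remains, and \<open>game_of_dom\<close> takes over
  with no regard to the inner game. The hypothesis \<open>game_equiv\<close> serves moves that enter
  the inserted word from a context, where no inner game is running.\<close>

lemma game_of_linked:
  assumes "u \<noteq> []" "v \<noteq> []" "set u \<subseteq> set C" "set u \<subseteq> set D"
    and "Suc n * P + 1 < c" "Suc n * P + 1 < length D"
    and "game_equiv k n u v" "linked k n u i v j"
  shows "game same_order (Suc k) n (word u) i (word v) j"
  using assms
proof (induction n arbitrary: k u v i j)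
  case 0
  then show ?case using linked_agree by simp
next
  case (Suc n)
  have len: "Suc n * P + 1 < c" "Suc n * P + 1 < length D" using Suc.prems by auto
  have sets: "set u = set v" using game_equiv_set[OF Suc.prems(7)] .
  have eq: "game_equiv k n u v" using game_equiv_mono[OF Suc.prems(7)] by simp
  have mid: "al u i = c \<Longrightarrow> game same_order k (Suc n) u (i - c) v (j - c)"
    using Suc.prems(8) unfolding linked_def by blast
  have al: "al u i = al v j" using Suc.prems(8) unfolding linked_def by blast
  have "\<exists>j'<length (word v). same_order i i' j j' \<and>
      game same_order (Suc k) n (word u) i' (word v) j'" if i': "i' < length (word u)" for i'
  proof -
    obtain j' where j': "linked k n u i' v j'" "same_order i i' j j'"
    proof (rule linked_reply[OF Suc.prems(8,1,2) i'])
      show "\<exists>b'<length v. game same_order k n u a' v b'" if "a' < length u" for a'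
        using game_equivD[OF eq that] .
      show "\<exists>b'<length v. same_order (i - c) a' (j - c) b' \<and> game same_order k n u a' v b'"
        if "al u i = c" "a' < length u" for a'
        using game_forth[OF mid] that by blast
    qed
    then show ?thesis
      using Suc.IH[OF Suc.prems(1-4) len eq j'(1)] unfolding linked_def by blast
  qed
  moreover have "\<exists>i'<length (word u). same_order i i' j j' \<and>
      game same_order k n (word v) j' (word u) i'" if j': "j' < length (word v)" for j'
  proof (cases k)
    case 0
    have "word v ! j = word u ! i"
      using linked_agree[OF Suc.prems(8,1,2)] unfolding agree_def by simp
    then have d: "dom (Suc n) v j u i" using al by (intro dom_of_al_eq) auto
    have b: "j < length (word v)" "i < length (word u)"
      using Suc.prems(8) unfolding linked_def by blast+
    have "game same_order 0 (Suc n) (word v) j (word u) i"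
      using game_of_dom[OF Suc.prems(1,2) sets _ _ Suc.prems(5,6) d b] Suc.prems(3,4) sets by blast
    from game_forth[OF this j'] show ?thesis unfolding 0 same_order_swap[of j] by blast
  next
    case (Suc k')
    have eq': "game_equiv k' n v u"
      using game_equiv_mono[OF game_equiv_sym[OF eq]] Suc by simp
    \<comment> \<open>The inner game is reversed by a switch on the spot, which restores the
      invariant with the words exchanged.\<close>
    have "game same_order k' n v (j - c) u (i - c)" if c: "al v j = c"
    proof (rule game_swap)
      show "game same_order (Suc k') (Suc n) u (i - c) v (j - c)" using mid c al Suc by metis
      show "j - c < length v" using al_eq_c[OF Suc.prems(2), of j] c by auto
    qed (rule same_order_refl)
    then have l: "linked k' n v j u i"
      using Suc.prems(8) unfolding linked_def by presburger
    obtain i' where i': "linked k' n v j' u i'" "same_order j j' i i'"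
    proof (rule linked_reply[OF l Suc.prems(2,1) j'])
      show "\<exists>b'<length u. game same_order k' n v a' u b'" if "a' < length v" for a'
        using game_equivD[OF eq' that] .
      show "\<exists>b'<length u. same_order (j - c) a' (i - c) b' \<and> game same_order k' n v a' u b'"
        if "al v j = c" "a' < length v" for a'
      proof -
        have "game same_order (Suc k') (Suc n) u (i - c) v (j - c)"
          using mid that(1) al Suc by metis
        from game_back[OF this that(2)] show ?thesis
          unfolding same_order_swap[of "j - c"] by blast
      qed
    qed
    have "game same_order (Suc k') n (word v) j' (word u) i'"
      using Suc.IH[OF Suc.prems(2,1) _ _ len eq' i'(1)] Suc.prems(3,4) sets by simp
    then show ?thesis using i' Suc unfolding linked_def same_order_swap[of j] by blast
  qed
  ultimately show ?case
    using linked_agree[OF Suc.prems(8,1,2)] by (simp del: length_append)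
qed

lemma game_equiv_sandwich:
  assumes "u \<noteq> []" "v \<noteq> []" "set u \<subseteq> set C" "set u \<subseteq> set D"
    and "Suc n * P + 1 < c" "Suc n * P + 1 < length D"
    and "game_equiv k n u v"
  shows "game_equiv (Suc k) n (word u) (word v)"
proof -
  have *: "\<exists>j<length (word v). game same_order (Suc k) n (word u) i (word v) j"
    if uv: "u \<noteq> []" "v \<noteq> []" "set u \<subseteq> set C" "set u \<subseteq> set D" "game_equiv k n u v"
      and i: "i < length (word u)" for u v i
  proof -
    have "\<exists>j. linked k n u i v j"
    proof (cases "al u i = c")
      case False
      then show ?thesis
        using al_surj[OF uv(2) al_less_T[OF i]] i unfolding linked_def by metis
    next
      case True
      then have "i - c < length u" using al_eq_c[OF uv(1), of i] by auto
      then obtain b where "b < length v" "game same_order k n u (i - c) v b"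
        using game_equivD[OF uv(5)] by blast
      then have "linked k n u i v (c + b)"
        using mid_position[OF uv(2), of b] True i unfolding linked_def by simp
      then show ?thesis ..
    qed
    then obtain j where "linked k n u i v j" ..
    then show ?thesis
      using game_of_linked[OF uv(1-4) assms(5,6) uv(5)] unfolding linked_def by blast
  qed
  have "set v \<subseteq> set C" "set v \<subseteq> set D"
    using game_equiv_set[OF assms(7)] assms(3,4) by simp_all
  from *[OF assms(1-4,7)] *[OF assms(2,1) this game_equiv_sym[OF assms(7)]]
  show ?thesis by (rule game_equivI)
qed

end

text \<open>The word \<open>z 0 1 ... (a - 1)\<close> repeated \<open>N\<close> times and closed by
  one more \<open>z\<close>. Beginning and ending with \<open>z\<close>, it fits both sides: the
  left context must end, the right one begin, with its new letter.\<close>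

definition periodic :: "nat \<Rightarrow> nat \<Rightarrow> nat \<Rightarrow> nat list" where
  "periodic a z N = map (\<lambda>p. if p mod Suc a = 0 then z else p mod Suc a - 1) [0..<N * Suc a + 1]"

lemma length_periodic [simp]: "length (periodic a z N) = N * Suc a + 1"
  by (simp add: periodic_def)

lemma nth_periodic:
  "p < N * Suc a + 1 \<Longrightarrow> periodic a z N ! p = (if p mod Suc a = 0 then z else p mod Suc a - 1)"
  unfolding periodic_def by (subst nth_map) (simp_all del: upt_Suc)

lemma hit_residue:
  fixes P r p :: nat
  assumes "r < P"
  shows "\<exists>q\<ge>p. q < p + P \<and> q mod P = r"
proof (cases "p mod P \<le> r")
  case True
  let ?q = "p div P * P + r"
  have "?q mod P = r" using assms by simp
  moreover have "p = p div P * P + p mod P" by simp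
  then have "p \<le> ?q" "?q < p + P" using True assms by linarith+
  ultimately show ?thesis by blast
next
  case False
  let ?q = "Suc (p div P) * P + r"
  have "?q mod P = r" using assms by (metis mod_less mod_mult_self3)
  moreover have "p = p div P * P + p mod P" by simp
  moreover have "p mod P < P" using assms by simp
  ultimately have "p \<le> ?q" "?q < p + P" "?q mod P = r" using False assms by (simp_all, linarith+)
  then show ?thesis by blast
qed

lemma periodic_rich:
  assumes "p + Suc a \<le> length (periodic a z N)" "b \<in> insert z {..<a}"
  shows "\<exists>q\<ge>p. q < p + Suc a \<and> periodic a z N ! q = b"
proof -
  define r where "r = (if b = z then 0 else Suc b)"
  have "r < Suc a" using assms(2) by (auto simp: r_def)
  then obtain q where q: "q \<ge> p" "q < p + Suc a" "q mod Suc a = r"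
    using hit_residue by blast
  then have "q < N * Suc a + 1" using assms(1) by simp
  then have "periodic a z N ! q = b" using q(3) by (simp add: nth_periodic r_def)
  then show ?thesis using q by blast
qed

lemma set_periodic:
  assumes "N > 0"
  shows "set (periodic a z N) = insert z {..<a}"
proof
  have "p mod Suc a - 1 < a" if "p mod Suc a \<noteq> 0" for p
    using that mod_less_divisor[of "Suc a" p] by linarith
  then show "set (periodic a z N) \<subseteq> insert z {..<a}"
    unfolding periodic_def by auto
  show "insert z {..<a} \<subseteq> set (periodic a z N)"
  proof
    fix b assume b: "b \<in> insert z {..<a}"
    have "0 + Suc a \<le> length (periodic a z N)" using assms by (cases N) auto
    then obtain q where "q < Suc a" "periodic a z N ! q = b"
      using periodic_rich[OF _ b] by (metis add_0)
    moreover have "Suc a \<le> length (periodic a z N)" using assms by (cases N) auto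
    ultimately show "b \<in> set (periodic a z N)" by (metis less_le_trans nth_mem)
  qed
qed

lemma periodic_context:
  assumes "N > 0"
  shows "rich_context (periodic a y N) (periodic a z N) (Suc a)"
proof
  show "periodic a y N \<noteq> []" "periodic a z N \<noteq> []"
    by (metis length_0_conv length_periodic add_is_0 one_neq_zero)+
qed (use periodic_rich set_periodic[OF assms] in blast)+

section \<open>Words indistinguishable with one block of quantifiers\<close>

text \<open>For \<open>e = 1\<close> this is \<open>0 1 2 1 2 ... 1 2 0\<close>, for
  \<open>e = 0\<close> it is \<open>0 2 1 2 1 ... 2 1 0\<close>. The letter 0 makes the ends alike,
  as \<open>agree\<close> demands; at every inner position the two words differ.\<close>

definition zigzag :: "nat \<Rightarrow> nat \<Rightarrow> nat list" where
  "zigzag N e = map (\<lambda>p. if p = 0 \<or> p = 2 * N + 1 then 0 else 1 + (p + e) mod 2) [0..<2 * N + 2]"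

lemma length_zigzag [simp]: "length (zigzag N e) = 2 * N + 2"
  by (simp add: zigzag_def)

lemma nth_zigzag:
  "p < 2 * N + 2 \<Longrightarrow> zigzag N e ! p = (if p = 0 \<or> p = 2 * N + 1 then 0 else 1 + (p + e) mod 2)"
  unfolding zigzag_def by (subst nth_map) (simp_all del: upt_Suc)

text \<open>Inner replies have the opposite parity, because equal positions carry different letters.
  On each side \<open>q\<close> has at least the room of \<open>p\<close> or two positions per
  remaining move, as any letter recurs within two steps.\<close>

definition zz_dom :: "nat \<Rightarrow> nat \<Rightarrow> nat \<Rightarrow> nat \<Rightarrow> bool" where
  "zz_dom N n p q \<longleftrightarrow> p = 0 \<and> q = 0 \<or> p = 2 * N + 1 \<and> q = 2 * N + 1 \<or>
     0 < p \<and> p < 2 * N + 1 \<and> 0 < q \<and> q < 2 * N + 1 \<and> odd (p + q) \<and>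
     (p \<le> q \<or> 2 * n + 1 \<le> q) \<and> (q \<le> p \<or> q + 2 * n \<le> 2 * N)"

lemma zz_dom_start:
  assumes "2 * n + 2 \<le> N" "p < 2 * N + 2"
  shows "\<exists>q<2 * N + 2. zz_dom N n p q"
proof -
  consider "p = 0" | "p = 2 * N + 1" | "0 < p" "p \<le> 2 * n + 1" | "2 * n + 1 < p" "p < 2 * N + 1"
    using assms(2) by linarith
  then show ?thesis
  proof cases
    case 1 then show ?thesis by (intro exI[of _ 0]) (simp add: zz_dom_def)
  next
    case 2 then show ?thesis by (intro exI[of _ p]) (simp add: zz_dom_def)
  next
    case 3 then show ?thesis using assms by (intro exI[of _ "p + 1"]) (auto simp: zz_dom_def)
  next
    case 4 then show ?thesis using assms by (intro exI[of _ "p - 1"]) (auto simp: zz_dom_def)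
  qed
qed

text \<open>When \<open>p'\<close> is well to the right of \<open>q\<close>, one of its neighbours
  is a reply: the right one near the left end, otherwise the left one. When it is not, the next
  position after \<open>q\<close> of the right parity is taken, at a cost of at most 2.\<close>

lemma zz_dom_move_right:
  assumes N: "2 * n + 4 \<le> N" and d: "zz_dom N (Suc n) p q" and p: "p < p'" "p' < 2 * N + 2"
  shows "\<exists>q'<2 * N + 2. q < q' \<and> zz_dom N n p' q'"
proof -
  have q: "q \<noteq> 2 * N + 1" "q < 2 * N + 1" using d p by (auto simp: zz_dom_def)
  have oddq: "p = 0 \<and> q = 0 \<or> odd (p + q)" using d p by (auto simp: zz_dom_def)
  consider "p' = 2 * N + 1" | "p' < 2 * N + 1" "q + 1 < p'" "p' \<le> 2 * n + 1"
    | "p' < 2 * N + 1" "q + 1 < p'" "2 * n + 1 < p'"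
    | "p' < 2 * N + 1" "p' \<le> q + 1" "odd (p' + q)" | "p' < 2 * N + 1" "p' \<le> q + 1" "even (p' + q)"
    using p(2) by linarith
  then show ?thesis
  proof cases
    case 1
    then show ?thesis using q by (intro exI[of _ p']) (simp add: zz_dom_def)
  next
    case 2
    then show ?thesis using N p by (intro exI[of _ "p' + 1"]) (auto simp: zz_dom_def)
  next
    case 3
    then show ?thesis by (intro exI[of _ "p' - 1"]) (auto simp: zz_dom_def)
  next
    case 4
    have "q + 2 * Suc n \<le> 2 * N" using d p 4 N oddq
      by (cases "p = q") (auto simp: zz_dom_def)
    then show ?thesis using 4 p by (intro exI[of _ "q + 2"]) (auto simp: zz_dom_def)
  next
    case 5
    have "q + 2 * Suc n \<le> 2 * N" using d p 5 N oddq
      by (cases "p = q") (auto simp: zz_dom_def)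
    then show ?thesis using 5 p by (intro exI[of _ "q + 1"]) (auto simp: zz_dom_def)
  qed
qed

lemma zz_dom_mirror:
  assumes "zz_dom N n p q"
  shows "zz_dom N n (2 * N + 1 - p) (2 * N + 1 - q)"
  using assms unfolding zz_dom_def by auto

lemma zz_dom_move_left:
  assumes N: "2 * n + 4 \<le> N" and d: "zz_dom N (Suc n) p q" and p: "p' < p" "p < 2 * N + 2"
  shows "\<exists>q'<2 * N + 2. q' < q \<and> zz_dom N n p' q'"
proof -
  have "2 * N + 1 - p < 2 * N + 1 - p'" "2 * N + 1 - p' < 2 * N + 2" using p by linarith+
  then obtain q' where q': "q' < 2 * N + 2" "2 * N + 1 - q < q'" "zz_dom N n (2 * N + 1 - p') q'"
    using zz_dom_move_right[OF N zz_dom_mirror[OF d]] by blast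
  have "2 * N + 1 - (2 * N + 1 - p') = p'" using p by simp
  then have "zz_dom N n p' (2 * N + 1 - q')" using zz_dom_mirror[OF q'(3)] by simp
  moreover have "2 * N + 1 - q' < q" "2 * N + 1 - q' < 2 * N + 2" using q' by linarith+
  ultimately show ?thesis by blast
qed

lemma zz_dom_Suc: "zz_dom N (Suc n) p q \<Longrightarrow> zz_dom N n p q"
  by (auto simp: zz_dom_def)

lemma zz_agree:
  assumes "zz_dom N n p q" "p < 2 * N + 2" "q < 2 * N + 2" "e + e' = 1"
  shows "agree (zigzag N e) p (zigzag N e') q"
proof -
  have "(p + e) mod 2 = (q + e') mod 2" if "odd (p + q)"
    using that assms(4) by presburger
  then have "zigzag N e ! p = zigzag N e' ! q"
    using assms(1) unfolding nth_zigzag[OF assms(2)] nth_zigzag[OF assms(3)] zz_dom_def by auto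
  moreover have "p = 0 \<longleftrightarrow> q = 0" "p = 2 * N + 1 \<longleftrightarrow> q = 2 * N + 1"
    using assms(1) unfolding zz_dom_def by auto
  ultimately show ?thesis by (simp add: agree_def)
qed

lemma zigzag_game:
  assumes "zz_dom N n p q" "p < 2 * N + 2" "q < 2 * N + 2" "e + e' = 1" "2 * n + 4 \<le> N"
  shows "game same_order 0 n (zigzag N e) p (zigzag N e') q"
  using assms
proof (induction n arbitrary: p q)
  case 0
  then show ?case using zz_agree by simp
next
  case (Suc n)
  note IH = Suc.IH[OF _ _ _ Suc.prems(4)]
  have N: "2 * n + 4 \<le> N" using Suc.prems(5) by simp
  have "\<exists>q'<2 * N + 2. same_order p p' q q' \<and> game same_order 0 n (zigzag N e) p' (zigzag N e') q'"
    if p': "p' < 2 * N + 2" for p'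
  proof -
    consider "p < p'" | "p' = p" | "p' < p" by linarith
    then show ?thesis
    proof cases
      case 1
      then show ?thesis
        using zz_dom_move_right[OF N Suc.prems(1) 1 p'] IH[OF _ p' _ N] same_orderI(1) by blast
    next
      case 2
      then show ?thesis
        using zz_dom_Suc[OF Suc.prems(1)] IH[OF _ Suc.prems(2,3) N] Suc.prems(3) same_orderI(3)
        by blast
    next
      case 3
      then show ?thesis
        using zz_dom_move_left[OF N Suc.prems(1) 3 Suc.prems(2)] IH[OF _ p' _ N] same_orderI(2)
        by blast
    qed
  qed
  then show ?case using zz_agree[OF Suc.prems(1-4)] by simp
qed

lemma zigzag_equiv: "game_equiv 0 n (zigzag (2 * n + 4) 1) (zigzag (2 * n + 4) 0)"
proof (rule game_equivI)
  have *: "\<exists>q<length (zigzag (2 * n + 4) e').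
      game same_order 0 n (zigzag (2 * n + 4) e) p (zigzag (2 * n + 4) e') q"
    if e: "e + e' = 1" and p: "p < length (zigzag (2 * n + 4) e)" for e e' p
  proof -
    have "p < 2 * (2 * n + 4) + 2" using p by simp
    moreover from this obtain q where "q < 2 * (2 * n + 4) + 2" "zz_dom (2 * n + 4) n p q"
      using zz_dom_start[of n "2 * n + 4" p] by auto
    ultimately show ?thesis using zigzag_game[of "2 * n + 4" n p q e e'] e by auto
  qed
  from *[of 1 0] *[of 0 1]
  show "\<And>i. i < length (zigzag (2 * n + 4) 1) \<Longrightarrow> \<exists>j<length (zigzag (2 * n + 4) 0).
      game same_order 0 n (zigzag (2 * n + 4) 1) i (zigzag (2 * n + 4) 0) j"
    "\<And>j. j < length (zigzag (2 * n + 4) 0) \<Longrightarrow> \<exists>i<length (zigzag (2 * n + 4) 1).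
      game same_order 0 n (zigzag (2 * n + 4) 0) j (zigzag (2 * n + 4) 1) i"
    by auto
qed

section \<open>Relativization\<close>

text \<open>Two guards, because negation is confined to atoms: \<open>H\<close> stands for the
  negation of \<open>G\<close> in universal quantifiers.\<close>

fun relativize :: "(var \<Rightarrow> 'a fo2) \<Rightarrow> (var \<Rightarrow> 'a fo2) \<Rightarrow> 'a fo2 \<Rightarrow> 'a fo2" where
  "relativize G H (And \<phi> \<psi>) = And (relativize G H \<phi>) (relativize G H \<psi>)"
| "relativize G H (Or \<phi> \<psi>) = Or (relativize G H \<phi>) (relativize G H \<psi>)"
| "relativize G H (Ex v \<phi>) = Ex v (And (G v) (relativize G H \<phi>))"
| "relativize G H (All v \<phi>) = All v (Or (H v) (relativize G H \<phi>))"
| "relativize G H \<phi> = \<phi>"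

fun suc_free :: "'a fo2 \<Rightarrow> bool" where
  "suc_free (Succ u v) = False"
| "suc_free (NSucc u v) = False"
| "suc_free (And \<phi> \<psi>) = (suc_free \<phi> \<and> suc_free \<psi>)"
| "suc_free (Or \<phi> \<psi>) = (suc_free \<phi> \<and> suc_free \<psi>)"
| "suc_free (Ex v \<phi>) = suc_free \<phi>"
| "suc_free (All v \<phi>) = suc_free \<phi>"
| "suc_free \<phi> = True"

lemma sat_cong: "(\<And>v. v \<in> free \<phi> \<Longrightarrow> s v = s' v) \<Longrightarrow> sat w s \<phi> \<longleftrightarrow> sat w s' \<phi>"
proof (induction \<phi> arbitrary: s s')
  case (And \<phi> \<psi>)
  have "sat w s \<phi> \<longleftrightarrow> sat w s' \<phi>" by (rule And.IH(1)) (use And.prems in simp)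
  moreover have "sat w s \<psi> \<longleftrightarrow> sat w s' \<psi>" by (rule And.IH(2)) (use And.prems in simp)
  ultimately show ?case by simp
next
  case (Or \<phi> \<psi>)
  have "sat w s \<phi> \<longleftrightarrow> sat w s' \<phi>" by (rule Or.IH(1)) (use Or.prems in simp)
  moreover have "sat w s \<psi> \<longleftrightarrow> sat w s' \<psi>" by (rule Or.IH(2)) (use Or.prems in simp)
  ultimately show ?case by simp
next
  case (Ex v \<phi>)
  have "sat w (s(v := i)) \<phi> \<longleftrightarrow> sat w (s'(v := i)) \<phi>" for i
    by (rule Ex.IH) (use Ex.prems in simp)
  then show ?case by simp
next
  case (All v \<phi>)
  have "sat w (s(v := i)) \<phi> \<longleftrightarrow> sat w (s'(v := i)) \<phi>" for i
    by (rule All.IH) (use All.prems in simp)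
  then show ?case by simp
qed simp_all

lemma sat_sentence: "sentence \<phi> \<Longrightarrow> sat w s \<phi> \<longleftrightarrow> sat w s' \<phi>"
  by (rule sat_cong) (simp add: sentence_def)

lemma sat_relativize:
  assumes mono: "\<And>i j. i < length w \<Longrightarrow> j < length w \<Longrightarrow> e i < e j \<longleftrightarrow> i < j"
    and e: "\<And>i. i < length w \<Longrightarrow> e i < length W \<and> W ! e i = w ! i"
    and G: "\<And>s v. s v < length W \<Longrightarrow> sat W s (G v) \<longleftrightarrow> (\<exists>i<length w. s v = e i)"
    and H: "\<And>s v. s v < length W \<Longrightarrow> sat W s (H v) \<longleftrightarrow> \<not> (\<exists>i<length w. s v = e i)"
    and "suc_free \<phi>" "\<And>v. s v < length w"
  shows "sat W (\<lambda>v. e (s v)) (relativize G H \<phi>) \<longleftrightarrow> sat w s \<phi>"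
proof -
  have inj: "e i = e j \<longleftrightarrow> i = j" if "i < length w" "j < length w" for i j
    using mono[OF that] mono[OF that(2,1)] by (cases i j rule: linorder_cases) auto
  show ?thesis
    using assms(5,6)
  proof (induction \<phi> arbitrary: s)
    case (Ex v \<phi>)
    have upd: "(\<lambda>x. e (s x))(v := e i) = (\<lambda>x. e ((s(v := i)) x))" for i by auto
    have IH: "sat W ((\<lambda>x. e (s x))(v := e i)) (relativize G H \<phi>) \<longleftrightarrow> sat w (s(v := i)) \<phi>"
      if "i < length w" for i
      unfolding upd by (rule Ex.IH) (use Ex.prems that in simp_all)
    have g: "sat W ((\<lambda>x. e (s x))(v := p)) (G v) \<longleftrightarrow> (\<exists>i<length w. p = e i)" if "p < length W" for p
      using G[of "(\<lambda>x. e (s x))(v := p)" v] that by simp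
    show ?case
    proof
      assume "sat W (\<lambda>v. e (s v)) (relativize G H (Ex v \<phi>))"
      then obtain p where p: "p < length W" "sat W ((\<lambda>x. e (s x))(v := p)) (G v)"
          "sat W ((\<lambda>x. e (s x))(v := p)) (relativize G H \<phi>)" by auto
      obtain i where "i < length w" "p = e i" using g[OF p(1)] p(2) by blast
      moreover from this have "sat w (s(v := i)) \<phi>" using IH p(3) by simp
      ultimately show "sat w s (Ex v \<phi>)" by auto
    next
      assume "sat w s (Ex v \<phi>)"
      then obtain i where i: "i < length w" "sat w (s(v := i)) \<phi>" by auto
      have l: "e i < length W" using e[OF i(1)] ..
      then have "sat W ((\<lambda>x. e (s x))(v := e i)) (G v)" using g[OF l] i(1) by blast
      moreover have "sat W ((\<lambda>x. e (s x))(v := e i)) (relativize G H \<phi>)" using IH i by simp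
      ultimately show "sat W (\<lambda>v. e (s v)) (relativize G H (Ex v \<phi>))" using l by auto
    qed
  next
    case (All v \<phi>)
    have upd: "(\<lambda>x. e (s x))(v := e i) = (\<lambda>x. e ((s(v := i)) x))" for i by auto
    have IH: "sat W ((\<lambda>x. e (s x))(v := e i)) (relativize G H \<phi>) \<longleftrightarrow> sat w (s(v := i)) \<phi>"
      if "i < length w" for i
      unfolding upd by (rule All.IH) (use All.prems that in simp_all)
    have h: "sat W ((\<lambda>x. e (s x))(v := p)) (H v) \<longleftrightarrow> \<not> (\<exists>i<length w. p = e i)" if "p < length W" for p
      using H[of "(\<lambda>x. e (s x))(v := p)" v] that by simp
    show ?case
    proof
      assume a: "sat W (\<lambda>v. e (s v)) (relativize G H (All v \<phi>))"
      have "sat w (s(v := i)) \<phi>" if i: "i < length w" for i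
      proof -
        have l: "e i < length W" using e[OF i] ..
        then have "\<not> sat W ((\<lambda>x. e (s x))(v := e i)) (H v)" using h[OF l] i by blast
        then have "sat W ((\<lambda>x. e (s x))(v := e i)) (relativize G H \<phi>)"
          using a l by (simp, blast)
        then show ?thesis using IH[OF i] by simp
      qed
      then show "sat w s (All v \<phi>)" by simp
    next
      assume a: "sat w s (All v \<phi>)"
      have "sat W ((\<lambda>x. e (s x))(v := p)) (Or (H v) (relativize G H \<phi>))" if p: "p < length W" for p
      proof (cases "\<exists>i<length w. p = e i")
        case True
        then obtain i where i: "i < length w" "p = e i" by blast
        have "sat w (s(v := i)) \<phi>" using a i(1) by simp
        then show ?thesis using IH[OF i(1)] i(2) by simp
      next
        case False
        then have "sat W ((\<lambda>x. e (s x))(v := p)) (H v)" using h[OF p] by blast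
        then show ?thesis by simp
      qed
      then show "sat W (\<lambda>v. e (s v)) (relativize G H (All v \<phi>))" by simp
    qed
  qed (simp_all add: mono e inj)
qed

lemma free_relativize:
  "(\<And>v. free (G v) \<subseteq> {v}) \<Longrightarrow> (\<And>v. free (H v) \<subseteq> {v}) \<Longrightarrow> free (relativize G H \<phi>) \<subseteq> free \<phi>"
  by (induction \<phi>) (auto, blast+)

lemma letters_relativize:
  "(\<And>v. letters (G v) \<subseteq> A) \<Longrightarrow> (\<And>v. letters (H v) \<subseteq> A) \<Longrightarrow> letters \<phi> \<subseteq> A \<Longrightarrow>
    letters (relativize G H \<phi>) \<subseteq> A"
  by (induction \<phi>) auto

lemma suc_free_relativize:
  "(\<And>v. suc_free (G v)) \<Longrightarrow> (\<And>v. suc_free (H v)) \<Longrightarrow> suc_free \<phi> \<Longrightarrow>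
    suc_free (relativize G H \<phi>)"
  by (induction \<phi>) auto

text \<open>Guards stand beside the relativized subformula, not above it. A path of the parse tree
  that enters a guard ends there, so \<open>d\<close> is paid once and not once per
  quantifier.\<close>

lemma blk_relativize:
  assumes "\<And>v. blk (Some True) (G v) \<le> d" "\<And>v. blk (Some False) (H v) \<le> d"
  shows "blk p (relativize G H \<phi>) \<le> blk p \<phi> + d"
proof (induction \<phi> arbitrary: p)
  case (And \<phi> \<psi>)
  show ?case using And.IH(1)[of p] And.IH(2)[of p] by (auto simp: max_def)
next
  case (Or \<phi> \<psi>)
  show ?case using Or.IH(1)[of p] Or.IH(2)[of p] by (auto simp: max_def)
qed (auto simp: trans_le_add2 assms)

text \<open>Only \<open>v\<close> is free, so the other variable can be requantified and two
  variables suffice. The universal quantifier below a guarded existential one opens exactly one new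
  block; \<open>not_between\<close> is the dual.\<close>

definition between :: "'a \<Rightarrow> 'a \<Rightarrow> var \<Rightarrow> 'a fo2" where
  "between x y v = All (other v)
     (And (Or (Less (other v) v) (NLett x (other v))) (Or (Less v (other v)) (NLett y (other v))))"

definition not_between :: "'a \<Rightarrow> 'a \<Rightarrow> var \<Rightarrow> 'a fo2" where
  "not_between x y v = Ex (other v)
     (Or (And (NLess (other v) v) (Lett x (other v))) (And (NLess v (other v)) (Lett y (other v))))"

lemma sat_not_between: "sat w s (not_between x y v) \<longleftrightarrow> \<not> sat w s (between x y v)"
  by (auto simp: between_def not_between_def)

lemma sat_between:
  assumes "C \<noteq> []" "D \<noteq> []" "last C = x" "hd D = y" "x \<notin> set u \<union> set D" "y \<notin> set u \<union> set C"
    and s: "s v < length (C @ u @ D)"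
  shows "sat (C @ u @ D) s (between x y v) \<longleftrightarrow> (\<exists>i<length u. s v = length C + i)"
proof -
  let ?W = "C @ u @ D"
  have x: "?W ! (length C - 1) = x" "length C - 1 < length C"
    using assms(1,3) by (auto simp: nth_append last_conv_nth)
  have y: "?W ! (length C + length u) = y" "length C + length u < length ?W"
    using assms(2,4) by (auto simp: nth_append hd_conv_nth)
  have "sat ?W s (between x y v) \<longleftrightarrow>
      (\<forall>p<length ?W. (s v \<le> p \<longrightarrow> ?W ! p \<noteq> x) \<and> (p \<le> s v \<longrightarrow> ?W ! p \<noteq> y))"
    by (auto simp: between_def not_less simp del: length_append)
  also have "\<dots> \<longleftrightarrow> length C \<le> s v \<and> s v < length C + length u"
  proof
    assume a: "\<forall>p<length ?W. (s v \<le> p \<longrightarrow> ?W ! p \<noteq> x) \<and> (p \<le> s v \<longrightarrow> ?W ! p \<noteq> y)"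
    have "length C - 1 < length ?W" using x(2) by simp
    then have "\<not> s v \<le> length C - 1" using a x(1) by blast
    moreover have "\<not> length C + length u \<le> s v" using a y by blast
    ultimately show "length C \<le> s v \<and> s v < length C + length u" by linarith
  next
    assume a: "length C \<le> s v \<and> s v < length C + length u"
    have "?W ! p \<noteq> x" if "p < length ?W" "s v \<le> p" for p
    proof -
      have "?W ! p = (u @ D) ! (p - length C)" using that a by (simp add: nth_append)
      moreover have "p - length C < length (u @ D)" using that a by auto
      ultimately have "?W ! p \<in> set (u @ D)" using nth_mem by metis
      then show ?thesis using assms(5) by auto
    qed
    moreover have "?W ! p \<noteq> y" if "p < length ?W" "p \<le> s v" for p
    proof -
      have "p < length (C @ u)" using that a by auto
      then have "?W ! p \<in> set (C @ u)"
        using nth_mem[of p "C @ u"] nth_append[of "C @ u" D p] by simp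
      then show ?thesis using assms(6) by auto
    qed
    ultimately show "\<forall>p<length ?W. (s v \<le> p \<longrightarrow> ?W ! p \<noteq> x) \<and> (p \<le> s v \<longrightarrow> ?W ! p \<noteq> y)"
      by blast
  qed
  also have "\<dots> \<longleftrightarrow> (\<exists>i<length u. s v = length C + i)"
    by (metis le_add1 le_add_diff_inverse nat_add_left_cancel_less)
  finally show ?thesis .
qed

section \<open>Induction on the number of blocks, over the order alone\<close>

definition order_separable :: "nat \<Rightarrow> nat \<Rightarrow> nat fo2 \<Rightarrow> bool" where
  "order_separable k a \<phi> \<longleftrightarrow> sentence \<phi> \<and> suc_free \<phi> \<and> blocks \<phi> \<le> k + 2 \<and> letters \<phi> \<subseteq> {..<a} \<and>
     (\<forall>n. \<exists>u v. u \<noteq> [] \<and> v \<noteq> [] \<and> set u \<subseteq> {..<a} \<and> set v \<subseteq> {..<a} \<and> game_equiv k n u v \<and>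
       sat u (\<lambda>_. 0) \<phi> \<and> \<not> sat v (\<lambda>_. 0) \<phi>)"

text \<open>Some 1 has no 2 before it: true of \<open>0 1 2 ...\<close> by its position 1, false of
  \<open>0 2 1 ...\<close>, where every 1 comes after the 2 at position 1.\<close>

lemma order_separable_0:
  "order_separable 0 3 (Ex VX (And (Lett 1 VX) (All VY (Or (NLess VY VX) (NLett 2 VY)))))"
  (is "order_separable 0 3 ?\<phi>")
proof -
  have "\<exists>u v. u \<noteq> [] \<and> v \<noteq> [] \<and> set u \<subseteq> {..<3} \<and> set v \<subseteq> {..<3} \<and> game_equiv 0 n u v \<and>
       sat u (\<lambda>_. 0) ?\<phi> \<and> \<not> sat v (\<lambda>_. 0) ?\<phi>" for n
  proof (intro exI conjI)
    let ?N = "2 * n + 4"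
    show "zigzag ?N 1 \<noteq> []" "zigzag ?N 0 \<noteq> []"
      by (metis length_0_conv length_zigzag add_is_0 zero_neq_numeral)+
    show "set (zigzag ?N 1) \<subseteq> {..<3}" "set (zigzag ?N 0) \<subseteq> {..<3}"
      by (auto simp: zigzag_def simp del: upt_Suc)
    show "game_equiv 0 n (zigzag ?N 1) (zigzag ?N 0)" by (rule zigzag_equiv)
    have "zigzag ?N 1 ! 1 = 1" "zigzag ?N 1 ! 0 = 0" by (simp_all add: nth_zigzag)
    then show "sat (zigzag ?N 1) (\<lambda>_. 0) ?\<phi>"
      by (auto intro!: exI[of _ 1])
    have "\<exists>q<2 * ?N + 2. q < p \<and> zigzag ?N 0 ! q = 2"
      if "p < 2 * ?N + 2" "zigzag ?N 0 ! p = 1" for p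
    proof (intro exI[of _ 1] conjI)
      show "zigzag ?N 0 ! 1 = 2" by (simp add: nth_zigzag)
      then have "p \<noteq> 1" using that(2) by auto
      moreover have "zigzag ?N 0 ! 0 = 0" by (simp add: nth_zigzag)
      then have "p \<noteq> 0" using that(2) by (metis zero_neq_one)
      ultimately show "1 < p" by simp
    qed simp
    then show "\<not> sat (zigzag ?N 0) (\<lambda>_. 0) ?\<phi>" by fastforce
  qed
  then show ?thesis
    by (auto simp: order_separable_def sentence_def blocks_def)
qed

lemma order_separable_Suc:
  assumes "order_separable k a \<phi>"
  shows "order_separable (Suc k) (a + 2)
    (relativize (between a (Suc a)) (not_between a (Suc a)) \<phi>)" (is "order_separable _ _ ?\<psi>")
proof -
  have \<phi>: "sentence \<phi>" "suc_free \<phi>" "blocks \<phi> \<le> k + 2" "letters \<phi> \<subseteq> {..<a}"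
    using assms unfolding order_separable_def by blast+
  have guards: "free (between a (Suc a) v) \<subseteq> {v}" "free (not_between a (Suc a) v) \<subseteq> {v}"
    "letters (between a (Suc a) v) \<subseteq> {..<a + 2}" "letters (not_between a (Suc a) v) \<subseteq> {..<a + 2}"
    "suc_free (between a (Suc a) v)" "suc_free (not_between a (Suc a) v)"
    "blk (Some True) (between a (Suc a) v) \<le> 1" "blk (Some False) (not_between a (Suc a) v) \<le> 1"
    for v
    by (auto simp: between_def not_between_def)
  have "sentence ?\<psi>"
    using free_relativize[OF guards(1,2), where \<phi> = \<phi>] \<phi>(1) by (auto simp: sentence_def)
  moreover have "suc_free ?\<psi>" using suc_free_relativize[OF guards(5,6) \<phi>(2)] .
  moreover have "blocks ?\<psi> \<le> Suc k + 2"
    using blk_relativize[of "between a (Suc a)" 1 "not_between a (Suc a)" None \<phi>] guards(7,8) \<phi>(3)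
    unfolding blocks_def by fastforce
  moreover have "letters ?\<psi> \<subseteq> {..<a + 2}"
    using \<phi>(4) by (intro letters_relativize guards) auto
  moreover have "\<exists>U V. U \<noteq> [] \<and> V \<noteq> [] \<and> set U \<subseteq> {..<a + 2} \<and> set V \<subseteq> {..<a + 2} \<and>
      game_equiv (Suc k) n U V \<and> sat U (\<lambda>_. 0) ?\<psi> \<and> \<not> sat V (\<lambda>_. 0) ?\<psi>" for n
  proof -
    obtain u v where uv: "u \<noteq> []" "v \<noteq> []" "set u \<subseteq> {..<a}" "set v \<subseteq> {..<a}" "game_equiv k n u v"
      "sat u (\<lambda>_. 0) \<phi>" "\<not> sat v (\<lambda>_. 0) \<phi>"
      using assms unfolding order_separable_def by blast
    \<comment> \<open>The new letters are \<open>a\<close> and \<open>Suc a\<close>. The sandwich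
      asks for more than \<open>Suc n\<close> periods and one position, so \<open>n + 2\<close>
      periods are taken.\<close>
    define C D where "C = periodic a a (n + 2)" and "D = periodic a (Suc a) (n + 2)"
    have len: "length C = (n + 2) * Suc a + 1" "length D = (n + 2) * Suc a + 1"
      by (simp_all only: C_def D_def length_periodic)
    have sets: "set C = insert a {..<a}" "set D = insert (Suc a) {..<a}"
      by (simp_all add: C_def D_def set_periodic)
    have ne: "C \<noteq> []" "D \<noteq> []" using len by auto
    have ends: "last C = a" "hd D = Suc a"
    proof -
      have "last C = periodic a a (n + 2) ! ((n + 2) * Suc a)"
        using last_conv_nth[OF ne(1)] len(1) unfolding C_def by simp
      also have "\<dots> = a"
        by (subst nth_periodic) (simp_all only: mod_mult_self2_is_0 refl if_True less_add_one)
      finally show "last C = a" .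
      have "hd D = periodic a (Suc a) (n + 2) ! 0"
        using hd_conv_nth[OF ne(2)] unfolding D_def by simp
      then show "hd D = Suc a" by (simp add: nth_periodic)
    qed
    interpret rich_context C D "Suc a"
      unfolding C_def D_def by (rule periodic_context) simp
    have l: "Suc n * Suc a + 1 < length C" "Suc n * Suc a + 1 < length D"
      by (simp_all add: len)
    have "game_equiv (Suc k) n (C @ u @ D) (C @ v @ D)"
      using game_equiv_sandwich[OF uv(1,2) _ _ l uv(5)] uv(3) sets by blast
    moreover have "sat (C @ w @ D) (\<lambda>_. 0) ?\<psi> \<longleftrightarrow> sat w (\<lambda>_. 0) \<phi>"
      if w: "w \<noteq> []" "set w \<subseteq> {..<a}" for w
    proof -
      have b: "sat (C @ w @ D) s (between a (Suc a) x) \<longleftrightarrow> (\<exists>i<length w. s x = length C + i)"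
        if "s x < length (C @ w @ D)" for s x
        by (rule sat_between[OF ne ends]) (use w(2) sets that in auto)
      \<comment> \<open>The embedding sends the default position 0 to \<open>length C + 0\<close>;
        since the relativized formula is a sentence, the change of assignment is harmless.\<close>
      have "sat (C @ w @ D) (\<lambda>_. length C + 0) ?\<psi> \<longleftrightarrow> sat w (\<lambda>_. 0) \<phi>"
      proof (rule sat_relativize[where e = "\<lambda>i. length C + i"])
        show "sat (C @ w @ D) s (not_between a (Suc a) x) \<longleftrightarrow>
            \<not> (\<exists>i<length w. s x = length C + i)" if "s x < length (C @ w @ D)" for s x
          unfolding sat_not_between b[of s x, OF that] ..
        show "sat (C @ w @ D) s (between a (Suc a) x) \<longleftrightarrow> (\<exists>i<length w. s x = length C + i)"
          if "s x < length (C @ w @ D)" for s x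
          using that by (rule b)
      qed (use w(1) \<phi>(2) in \<open>auto simp: nth_append\<close>)
      then show ?thesis using sat_sentence[OF \<open>sentence ?\<psi>\<close>] by blast
    qed
    ultimately show ?thesis
      using uv sets ne by (intro exI[of _ "C @ u @ D"] exI[of _ "C @ v @ D"]) auto
  qed
  ultimately show ?thesis unfolding order_separable_def by blast
qed

lemma order_separable_ex: "\<exists>a \<phi>. order_separable k a \<phi>"
proof (induction k)
  case 0
  show ?case using order_separable_0 by blast
next
  case (Suc k)
  then show ?case using order_separable_Suc by blast
qed

section \<open>Padding makes the successor relation useless\<close>

text \<open>Letter \<open>i\<close> sits at \<open>K + 2 * K * i\<close>, so that filler surrounds
  every letter, also at both ends.\<close>

definition pad :: "nat \<Rightarrow> 'a \<Rightarrow> 'a list \<Rightarrow> 'a list" where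
  "pad K h w = map (\<lambda>p. if p mod (2 * K) = K then w ! (p div (2 * K)) else h) [0..<2 * K * length w]"

lemma length_pad [simp]: "length (pad K h w) = 2 * K * length w"
  by (simp add: pad_def)

lemma nth_pad: "p < 2 * K * length w \<Longrightarrow>
    pad K h w ! p = (if p mod (2 * K) = K then w ! (p div (2 * K)) else h)"
  unfolding pad_def by (subst nth_map) simp_all

text \<open>A signed coordinate relative to letter \<open>q\<close>, which need not be the nearest
  one. The same position has several descriptions, and a strategy may choose among them.\<close>

definition offset :: "nat \<Rightarrow> nat \<Rightarrow> int \<Rightarrow> nat \<Rightarrow> bool" where
  "offset K q d p \<longleftrightarrow> int p = int (K + 2 * K * q) + d"

lemma offset_nth:
  assumes "offset K q d p" "\<bar>d\<bar> < 2 * int K" "p < 2 * K * length w"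
  shows "pad K h w ! p = (if d = 0 then w ! q else h)"
proof (cases "d = 0")
  case True
  then have "p = K + 2 * K * q" using assms(1) unfolding offset_def by linarith
  moreover have "K > 0" using assms(2) True by simp
  ultimately have "p mod (2 * K) = K" "p div (2 * K) = q" by simp_all
  then show ?thesis using True nth_pad[OF assms(3)] by simp
next
  case False
  have "p mod (2 * K) \<noteq> K"
  proof
    assume "p mod (2 * K) = K"
    moreover have "int p = int (2 * K) * int (p div (2 * K)) + int (p mod (2 * K))"
      by (metis of_nat_add of_nat_mult mult_div_mod_eq)
    ultimately have "d = int (2 * K) * (int (p div (2 * K)) - int q)"
      using assms(1) unfolding offset_def by (simp add: algebra_simps)
    then have "int (2 * K) dvd d" by simp
    then show False using False assms(2) zdvd_imp_le[of "int (2 * K)" "\<bar>d\<bar>"] by simp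
  qed
  then show ?thesis using False nth_pad[OF assms(3)] by simp
qed

text \<open>Offsets below \<open>2 * K\<close> can leave the word only from the first or the last
  letter, and there \<open>q\<close> and \<open>q'\<close> are at the same end.\<close>

lemma offset_range:
  assumes p: "offset K q d p" "p < 2 * K * L" and d: "\<bar>d\<bar> < 2 * int K"
    and q: "q < L" "q' < L'" "q = 0 \<longleftrightarrow> q' = 0" "Suc q = L \<longleftrightarrow> Suc q' = L'"
  obtains p' where "offset K q' d p'" "p' < 2 * K * L'"
proof -
  have lo: "0 \<le> int (K + 2 * K * q') + d"
  proof (cases "q' = 0")
    case True
    then show ?thesis using p(1) q(3) unfolding offset_def by simp
  next
    case False
    then have "2 * K \<le> 2 * K * q'" by simp
    then show ?thesis using d by linarith
  qed
  have "int (K + 2 * K * q') + d < int (2 * K * L')"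
  proof (cases "Suc q' = L'")
    case True
    then have "L = Suc q" "L' = Suc q'" using q(4) by auto
    then show ?thesis using p unfolding offset_def \<open>L = Suc q\<close> \<open>L' = Suc q'\<close> mult_Suc_right
      by linarith
  next
    case False
    then have "Suc (Suc q') \<le> L'" using q(2) by simp
    then have "2 * K * Suc (Suc q') \<le> 2 * K * L'" by (rule mult_le_mono2)
    then show ?thesis using d unfolding mult_Suc_right by linarith
  qed
  then show ?thesis
    using that[of "nat (int (K + 2 * K * q') + d)"] lo unfolding offset_def by linarith
qed

lemma offset_agree:
  assumes a: "agree w q w' q'" and q: "q < length w" "q' < length w'"
    and d: "\<bar>d\<bar> < 2 * int K - 1"
    and p: "offset K q d p" "offset K q' d p'" "p < 2 * K * length w" "p' < 2 * K * length w'"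
  shows "agree (pad K h w) p (pad K h w') p'"
proof -
  have "\<bar>d\<bar> < 2 * int K" using d by simp
  then have "pad K h w ! p = pad K h w' ! p'"
    using offset_nth p a unfolding agree_def by metis
  moreover have "p = 0 \<longleftrightarrow> p' = 0"
  proof (cases "q = 0")
    case True
    then show ?thesis using a p(1,2) unfolding agree_def offset_def by auto
  next
    case False
    then have "q' \<noteq> 0" using a unfolding agree_def by blast
    then have "2 * K \<le> 2 * K * q" "2 * K \<le> 2 * K * q'" using False by simp_all
    then show ?thesis using d p(1,2) unfolding offset_def by linarith
  qed
  moreover have "Suc p = 2 * K * length w \<longleftrightarrow> Suc p' = 2 * K * length w'"
  proof (cases "Suc q = length w")
    case True
    then have l: "length w = Suc q" "length w' = Suc q'" using a unfolding agree_def by auto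
    show ?thesis using p(1,2) unfolding offset_def l mult_Suc_right by linarith
  next
    case False
    then have "Suc (Suc q) \<le> length w" "Suc (Suc q') \<le> length w'"
      using a q unfolding agree_def by auto
    then have "2 * K * Suc (Suc q) \<le> 2 * K * length w" "2 * K * Suc (Suc q') \<le> 2 * K * length w'"
      by (simp_all only: mult_le_mono2)
    then show ?thesis using d p(1,2) unfolding offset_def mult_Suc_right by linarith
  qed
  ultimately show ?thesis by (simp add: agree_def)
qed

text \<open>A move by at most \<open>M\<close> away from the current letter keeps the letter. For a longer move
  to the right the new position is described by an offset above \<open>M - 2 * K\<close>, so that even if
  the opponent's new letter is the very next one, the reply stays to the right of the old
  position and not adjacent to it.\<close>

lemma pad_reply:
  assumes M: "int K \<le> M" "M < 2 * int K" and d: "\<bar>d\<bar> < M"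
    and p: "offset K q d p" "offset K q' d p'"
    and q: "q < L" "q' < L'" "X q q'"
    and X: "\<And>a b. X a b \<Longrightarrow> (a = 0 \<longleftrightarrow> b = 0) \<and> (Suc a = L \<longleftrightarrow> Suc b = L')"
    and reply: "\<And>a. a < L \<Longrightarrow> \<exists>b<L'. same_order q a q' b \<and> X a b"
    and r: "r < 2 * K * L"
  shows "\<exists>a b d' r'. a < L \<and> b < L' \<and> X a b \<and> \<bar>d'\<bar> \<le> M \<and> offset K a d' r \<and> offset K b d' r' \<and>
    r' < 2 * K * L' \<and> same_suc_order p r p' r'"
proof -
  have K: "K > 0" using M by simp
  define e where "e = int r - int (K + 2 * K * q)"
  consider "\<bar>e\<bar> \<le> M" | "e > M" | "e < - M" by linarith
  then show ?thesis
  proof cases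
    case 1
    have o: "offset K q e r" by (simp add: offset_def e_def)
    have "\<bar>e\<bar> < 2 * int K" using 1 M by simp
    then obtain r' where r': "offset K q' e r'" "r' < 2 * K * L'"
      using offset_range[OF o r _ q(1,2)] X[OF q(3)] by blast
    have "int r - int p = int r' - int p'" using o r' p unfolding offset_def by linarith
    then have "same_suc_order p r p' r'" unfolding same_suc_order_def same_order_def by linarith
    then show ?thesis using o r' q 1 by blast
  next
    case 2
    \<comment> \<open>The shift makes division by \<open>2 * K\<close> select the letter from which
      \<open>r\<close> has an offset between \<open>M - 2 * K + 1\<close> and \<open>M\<close>. By
      \<open>K \<le> M\<close> its absolute value is at most \<open>M\<close>; the lower end
      together with \<open>\<bar>d\<bar> < M\<close> makes the reply at least two steps
      away.\<close>
    define t where "t = r + K - nat M - 1"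
    have t: "int t = int r + int K - M - 1" using 2 M unfolding t_def e_def by linarith
    define a where "a = t div (2 * K)"
    have tm: "t = 2 * K * a + t mod (2 * K)" "t mod (2 * K) < 2 * K" using K by (simp_all add: a_def)
    have "2 * K * Suc q \<le> t" using t 2 unfolding e_def mult_Suc_right by linarith
    then have qa: "q < a"
      unfolding a_def using K by (metis Suc_le_lessD less_eq_div_iff_mult_less_eq mult.commute
          nat_0_less_mult_iff zero_less_numeral)
    have "t < 2 * K * L" using t r M by linarith
    then have aL: "a < L" unfolding a_def by (simp add: less_mult_imp_div_less mult.commute)
    obtain b where b: "b < L'" "same_order q a q' b" "X a b" using reply[OF aL] by blast
    define d' where "d' = int r - int (K + 2 * K * a)"
    have d': "M - 2 * int K + 1 \<le> d'" "d' \<le> M"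
      using tm t unfolding d'_def by linarith+
    have o: "offset K a d' r" by (simp add: offset_def d'_def)
    have "\<bar>d'\<bar> < 2 * int K" "\<bar>d'\<bar> \<le> M" using d' M by linarith+
    then obtain r' where r': "offset K b d' r'" "r' < 2 * K * L'"
      using offset_range[OF o r _ aL b(1)] X[OF b(3)] by blast
    have "q' < b" using b(2) qa unfolding same_order_def by blast
    then have "2 * K * Suc q' \<le> 2 * K * b" by (intro mult_le_mono2) simp
    then have "int (2 * K * q') + 2 * int K \<le> int (2 * K * b)"
      unfolding mult_Suc_right by linarith
    then have "int r' - int p' \<ge> 2" using r'(1) p(2) d' d unfolding offset_def by linarith
    moreover have "int r - int p \<ge> 2" using 2 p(1) d unfolding offset_def e_def by linarith
    ultimately have "same_suc_order p r p' r'"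
      unfolding same_suc_order_def same_order_def by linarith
    then show ?thesis using o r' aL b \<open>\<bar>d'\<bar> \<le> M\<close> by blast
  next
    case 3
    \<comment> \<open>The mirror image: the selected offset lies between \<open>- M\<close> and
      \<open>2 * K - 1 - M\<close>.\<close>
    define t where "t = r + nat M - K"
    have t: "int t = int r - int K + M" using M unfolding t_def by linarith
    define a where "a = t div (2 * K)"
    have tm: "t = 2 * K * a + t mod (2 * K)" "t mod (2 * K) < 2 * K" using K by (simp_all add: a_def)
    have "t < 2 * K * q" using t 3 unfolding e_def by linarith
    then have qa: "a < q" unfolding a_def by (simp add: less_mult_imp_div_less mult.commute)
    then have aL: "a < L" using q(1) by simp
    obtain b where b: "b < L'" "same_order q a q' b" "X a b" using reply[OF aL] by blast
    define d' where "d' = int r - int (K + 2 * K * a)"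
    have d': "- M \<le> d'" "d' \<le> 2 * int K - 1 - M"
      using tm t unfolding d'_def by linarith+
    have o: "offset K a d' r" by (simp add: offset_def d'_def)
    have "\<bar>d'\<bar> < 2 * int K" "\<bar>d'\<bar> \<le> M" using d' M by linarith+
    then obtain r' where r': "offset K b d' r'" "r' < 2 * K * L'"
      using offset_range[OF o r _ aL b(1)] X[OF b(3)] by blast
    have "b < q'" using b(2) qa unfolding same_order_def by blast
    then have "2 * K * Suc b \<le> 2 * K * q'" by (intro mult_le_mono2) simp
    then have "int (2 * K * b) + 2 * int K \<le> int (2 * K * q')"
      unfolding mult_Suc_right by linarith
    then have "int p' - int r' \<ge> 2" using r'(1) p(2) d' d unfolding offset_def by linarith
    moreover have "int p - int r \<ge> 2" using 3 p(1) d unfolding offset_def e_def by linarith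
    ultimately have "same_suc_order p r p' r'"
      unfolding same_suc_order_def same_order_def by linarith
    then show ?thesis using o r' aL b \<open>\<bar>d'\<bar> \<le> M\<close> by blast
  qed
qed

text \<open>\<open>N\<close> is the length of the whole game. The admissible offset grows by one per
  move, from \<open>K\<close> to \<open>K + N\<close>, which yields the strict inequality
  \<open>\<bar>d\<bar> < M\<close> wanted by \<open>pad_reply\<close>; \<open>N + 2 \<le> K\<close>
  keeps it below \<open>2 * K - 1\<close>.\<close>

lemma pad_game:
  assumes "n \<le> N" "N + 2 \<le> K"
    and "game same_order k n w q w' q'" "q < length w" "q' < length w'"
    and "\<bar>d\<bar> \<le> int (K + N - n)" "offset K q d p" "offset K q' d p'"
    and "p < 2 * K * length w" "p' < 2 * K * length w'"
  shows "game same_suc_order k n (pad K h w) p (pad K h w') p'"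
  using assms
proof (induction n arbitrary: k w q w' q' d p p')
  case 0
  then show ?case using offset_agree[of w q w' q' d K p p' h] by simp
next
  case (Suc n)
  define M where "M = int (K + N - n)"
  have M: "int K \<le> M" "M < 2 * int K - 1" "\<bar>d\<bar> < M"
    using Suc.prems(1,2,6) unfolding M_def by linarith+
  have nN: "n \<le> N" using Suc.prems(1) by simp
  note g = Suc.prems(3)
  have "\<exists>p1<length (pad K h w'). same_suc_order p r p' p1 \<and>
      game same_suc_order k n (pad K h w) r (pad K h w') p1" if r: "r < length (pad K h w)" for r
  proof -
    let ?X = "\<lambda>a b. game same_order k n w a w' b"
    have "\<exists>a b d' r'. a < length w \<and> b < length w' \<and> ?X a b \<and> \<bar>d'\<bar> \<le> M \<and> offset K a d' r \<and>
        offset K b d' r' \<and> r' < 2 * K * length w' \<and> same_suc_order p r p' r'"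
    proof (rule pad_reply[OF M(1) _ M(3) Suc.prems(7,8,4,5)])
      show "M < 2 * int K" using M(2) by simp
      show "?X q q'" using game_mono[OF g] by simp
      show "(a = 0 \<longleftrightarrow> b = 0) \<and> (Suc a = length w \<longleftrightarrow> Suc b = length w')" if "?X a b" for a b
        using game_agree[OF that] unfolding agree_def by blast
      show "\<exists>b<length w'. same_order q a q' b \<and> ?X a b" if "a < length w" for a
        using game_forth[OF g that] .
      show "r < 2 * K * length w" using r by simp
    qed
    then obtain a b d' r' where *: "a < length w" "b < length w'" "?X a b" "\<bar>d'\<bar> \<le> M"
      "offset K a d' r" "offset K b d' r'" "r' < 2 * K * length w'" "same_suc_order p r p' r'"
      by blast
    have "game same_suc_order k n (pad K h w) r (pad K h w') r'"
      using Suc.IH[OF nN Suc.prems(2) *(3,1,2) *(4)[unfolded M_def] *(5,6) _ *(7)] r by simp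
    then show ?thesis using *(7,8) by auto
  qed
  moreover have "\<exists>p1<length (pad K h w). same_suc_order p p1 p' r \<and>
      game same_suc_order (k - 1) n (pad K h w') r (pad K h w) p1"
    if k: "k > 0" and r: "r < length (pad K h w')" for r
  proof -
    obtain k' where k': "k = Suc k'" using k by (cases k) auto
    let ?X = "\<lambda>a b. game same_order k' n w' a w b"
    have g': "game same_order (Suc k') (Suc n) w q w' q'" using g k' by simp
    have "\<exists>a b d' r'. a < length w' \<and> b < length w \<and> ?X a b \<and> \<bar>d'\<bar> \<le> M \<and> offset K a d' r \<and>
        offset K b d' r' \<and> r' < 2 * K * length w \<and> same_suc_order p' r p r'"
    proof (rule pad_reply[OF M(1) _ M(3) Suc.prems(8,7,5,4)])
      show "M < 2 * int K" using M(2) by simp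
      show "?X q' q" using game_swap[OF g' Suc.prems(5)] same_order_refl by blast
      show "(a = 0 \<longleftrightarrow> b = 0) \<and> (Suc a = length w' \<longleftrightarrow> Suc b = length w)" if "?X a b" for a b
        using game_agree[OF that] unfolding agree_def by blast
      show "\<exists>b<length w. same_order q' a q b \<and> ?X a b" if "a < length w'" for a
        using game_back[OF g' that] unfolding same_order_swap[of q'] .
      show "r < 2 * K * length w'" using r by simp
    qed
    then obtain a b d' r' where *: "a < length w'" "b < length w" "?X a b" "\<bar>d'\<bar> \<le> M"
      "offset K a d' r" "offset K b d' r'" "r' < 2 * K * length w" "same_suc_order p' r p r'"
      by blast
    have "game same_suc_order k' n (pad K h w') r (pad K h w) r'"
      using Suc.IH[OF nN Suc.prems(2) *(3,1,2) *(4)[unfolded M_def] *(5,6) _ *(7)] r by simp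
    then show ?thesis using *(7) same_suc_order_swap[OF *(8)] k' by auto
  qed
  moreover have "agree (pad K h w) p (pad K h w') p'"
    using offset_agree[OF game_agree[OF g] Suc.prems(4,5) _ Suc.prems(7-10)] M by simp
  ultimately show ?case by simp
qed

lemma pad_matched:
  assumes eq: "game_equiv k n u v" and ne: "u \<noteq> []" "v \<noteq> []"
  shows "matched k n (pad (n + 2) h u) (\<lambda>_. 0) (pad (n + 2) h v) (\<lambda>_. 0)"
proof -
  let ?K = "n + 2"
  have "0 < length u" using ne by simp
  then obtain b where b: "b < length v" "game same_order k n u 0 v b"
    using game_equivD[OF eq] by blast
  then have "b = 0" using game_agree[OF b(2)] unfolding agree_def by simp
  then have g: "game same_order k n u 0 v 0" using b by simp
  \<comment> \<open>Both variables start at position 0, at distance \<open>K\<close> from the first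
    letter: exactly the offset allowed before any move.\<close>
  have o: "offset ?K 0 (- int ?K) 0" by (simp add: offset_def)
  have "game same_suc_order k n (pad ?K h u) 0 (pad ?K h v) 0"
    using pad_game[OF le_refl le_refl g _ _ _ o o] ne by simp
  then show ?thesis
    using ne unfolding matched_def by (simp add: same_suc_order_def same_order_def)
qed

lemma sat_pad:
  assumes "K > 0" "h \<notin> set w" "w \<noteq> []" "suc_free \<phi>"
    "sentence (relativize (NLett h) (Lett h) \<phi>)"
  shows "sat (pad K h w) (\<lambda>_. 0) (relativize (NLett h) (Lett h) \<phi>) \<longleftrightarrow> sat w (\<lambda>_. 0) \<phi>"
proof -
  define e where "e i = K + 2 * K * i" for i
  have range: "e i < 2 * K * length w" if "i < length w" for i
  proof -
    have "2 * K * Suc i \<le> 2 * K * length w" using that by (intro mult_le_mono2) simp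
    then show ?thesis using assms(1) unfolding e_def by simp
  qed
  have nth: "pad K h w ! e i = w ! i" if "i < length w" for i
    using nth_pad[OF range[OF that]] assms(1) unfolding e_def by simp
  have char: "pad K h w ! p \<noteq> h \<longleftrightarrow> (\<exists>i<length w. p = e i)" if p: "p < length (pad K h w)" for p
  proof
    assume "pad K h w ! p \<noteq> h"
    then have m: "p mod (2 * K) = K" using nth_pad[of p K w h] p by (auto split: if_splits)
    moreover have "p = 2 * K * (p div (2 * K)) + p mod (2 * K)" by simp
    ultimately have "p = e (p div (2 * K))" unfolding e_def by linarith
    moreover have "p div (2 * K) < length w"
      using p by (simp add: less_mult_imp_div_less mult.commute)
    ultimately show "\<exists>i<length w. p = e i" by blast
  next
    assume "\<exists>i<length w. p = e i"
    then show "pad K h w ! p \<noteq> h" using nth assms(2) by (metis nth_mem)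
  qed
  have "sat (pad K h w) (\<lambda>_. e 0) (relativize (NLett h) (Lett h) \<phi>) \<longleftrightarrow> sat w (\<lambda>_. 0) \<phi>"
  proof (rule sat_relativize)
    show "e i < e j \<longleftrightarrow> i < j" for i j using assms(1) by (simp add: e_def)
    show "e i < length (pad K h w) \<and> pad K h w ! e i = w ! i" if "i < length w" for i
      using range[OF that] nth[OF that] by simp
    show "sat (pad K h w) s (NLett h v) \<longleftrightarrow> (\<exists>i<length w. s v = e i)"
      if "s v < length (pad K h w)" for s v using char[OF that] by simp
    show "sat (pad K h w) s (Lett h v) \<longleftrightarrow> \<not> (\<exists>i<length w. s v = e i)"
      if "s v < length (pad K h w)" for s v using char[OF that] by (metis sat.simps(3))
  qed (use assms(3,4) in auto)
  then show ?thesis using sat_sentence[OF assms(5)] by blast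
qed

lemma set_pad: "set (pad K h w) \<subseteq> insert h (set w)"
proof -
  have "p div (2 * K) < length w" if "p < 2 * K * length w" for p
    using that by (simp add: less_mult_imp_div_less mult.commute)
  then show ?thesis unfolding pad_def by auto
qed

section \<open>Assembling the two languages\<close>

lemma sat_quantifier_free:
  "blocks \<phi> = 0 \<Longrightarrow> w ! 0 = w' ! 0 \<Longrightarrow> sat w (\<lambda>_. 0) \<phi> \<longleftrightarrow> sat w' (\<lambda>_. 0) \<phi>"
  unfolding blocks_def by (induction \<phi>) auto

lemma FO2mI: "blocks \<phi> \<le> m \<Longrightarrow> \<phi> \<in> FO2m m"
  by (auto simp: FO2m_def FO2mn_def intro: bexI[of _ "max m (qdepth \<phi>)"])

lemma FO2mD: "\<phi> \<in> FO2m m \<Longrightarrow> blocks \<phi> \<le> m"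
  by (auto simp: FO2m_def FO2mn_def)

theorem theorem5p6:
  fixes m :: nat
  assumes "m \<ge> 1"
  shows "\<exists>(\<Sigma>::nat set) (\<phi>::nat fo2) K L.
           finite \<Sigma> \<and> sentence \<phi> \<and> \<phi> \<in> FO2m m \<and> letters \<phi> \<subseteq> \<Sigma> \<and>
           K \<subseteq> lists \<Sigma> \<and> L \<subseteq> lists \<Sigma> \<and>
           separates \<phi> K L \<and>
           (\<forall>\<psi>::nat fo2. sentence \<psi> \<and> \<psi> \<in> FO2m (m - 1) \<and> letters \<psi> \<subseteq> \<Sigma>
                \<longrightarrow> \<not> separates \<psi> K L)"
proof (cases "m = 1")
  case True
  \<comment> \<open>With no block allowed, only the letter at the default position 0 is visible, so
    the length of the word cannot be tested. The general construction starts at two blocks.\<close>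
  let ?\<phi> = "Ex VX (Ex VY (Less VX VY)) :: nat fo2"
  have "separates ?\<phi> {[0, 0]} {[0]}" by (auto simp: separates_def)
  moreover have "\<not> separates \<psi> {[0, 0]} {[0]}" if "\<psi> \<in> FO2m (m - 1)" for \<psi> :: "nat fo2"
    using sat_quantifier_free[of \<psi> "[0, 0]" "[0]"] FO2mD[OF that] True
    by (simp add: separates_def)
  moreover have "?\<phi> \<in> FO2m m" using True by (intro FO2mI) (simp add: blocks_def)
  ultimately show ?thesis
    by (intro exI[of _ "{0}"] exI[of _ ?\<phi>] exI[of _ "{[0, 0]}"] exI[of _ "{[0]}"])
      (auto simp: sentence_def)
next
  case False
  \<comment> \<open>The separating sentence has \<open>k + 2\<close> blocks, while \<open>k\<close>
    switches cover \<open>k + 1 = m - 1\<close> blocks.\<close>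
  define k where "k = m - 2"
  have m: "m = k + 2" using assms False unfolding k_def by simp
  obtain a \<phi> where sep: "order_separable k a \<phi>" using order_separable_ex by blast
  define good where "good n u v \<longleftrightarrow> u \<noteq> [] \<and> v \<noteq> [] \<and> set u \<subseteq> {..<a} \<and> set v \<subseteq> {..<a} \<and>
    game_equiv k n u v \<and> sat u (\<lambda>_. 0) \<phi> \<and> \<not> sat v (\<lambda>_. 0) \<phi>" for n u v
  have \<phi>: "sentence \<phi>" "suc_free \<phi>" "blocks \<phi> \<le> m" "letters \<phi> \<subseteq> {..<a}"
    and ex: "\<exists>u v. good n u v" for n
    using sep unfolding order_separable_def good_def m by blast+
  \<comment> \<open>All depths are collected, since a competing sentence may have any depth; it is
    defeated by the pair built for its own depth.\<close>
  define K where "K = {pad (n + 2) a u |n u v. good n u v}"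
  define L where "L = {pad (n + 2) a v |n u v. good n u v}"
  let ?\<psi> = "relativize (NLett a) (Lett a) \<phi>"
  have sent: "sentence ?\<psi>"
    using free_relativize[of "NLett a" "Lett a" \<phi>] \<phi>(1) by (auto simp: sentence_def)
  \<comment> \<open>Testing for the filler letter is quantifier-free, so removing the padding costs
    no block.\<close>
  have "blk None ?\<psi> \<le> blk None \<phi> + 0" by (rule blk_relativize) auto
  then have "?\<psi> \<in> FO2m m" using \<phi>(3) by (intro FO2mI) (simp add: blocks_def)
  moreover have "letters ?\<psi> \<subseteq> {..a}" using \<phi>(4) by (intro letters_relativize) auto
  moreover have pads: "pad (n + 2) a w \<in> lists {..a}" if "set w \<subseteq> {..<a}" for n w
    using set_pad[of "n + 2" a w] that by auto
  have "K \<subseteq> lists {..a}" "L \<subseteq> lists {..a}"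
    using pads unfolding K_def L_def good_def by blast+
  moreover have "separates ?\<psi> K L"
  proof -
    have "sat (pad (n + 2) a w) (\<lambda>_. 0) ?\<psi> \<longleftrightarrow> sat w (\<lambda>_. 0) \<phi>"
      if "w \<noteq> []" "set w \<subseteq> {..<a}" for n w
      using that sent \<phi>(2) by (intro sat_pad) auto
    then show ?thesis unfolding separates_def K_def L_def good_def by blast
  qed
  moreover have "\<not> separates \<chi> K L" if "\<chi> \<in> FO2m (m - 1)" for \<chi> :: "nat fo2"
  proof -
    obtain u v where uv: "good (qdepth \<chi>) u v" using ex by blast
    let ?u = "pad (qdepth \<chi> + 2) a u" and ?v = "pad (qdepth \<chi> + 2) a v"
    have eq: "game_equiv k (qdepth \<chi>) u v" and ne: "u \<noteq> []" "v \<noteq> []"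
      using uv unfolding good_def by simp_all
    have "matched k (qdepth \<chi>) ?u (\<lambda>_. 0) ?v (\<lambda>_. 0)" "matched k (qdepth \<chi>) ?v (\<lambda>_. 0) ?u (\<lambda>_. 0)"
      using pad_matched[OF eq ne] pad_matched[OF game_equiv_sym[OF eq] ne(2,1)] by simp_all
    then have "sat ?u (\<lambda>_. 0) \<chi> \<longleftrightarrow> sat ?v (\<lambda>_. 0) \<chi>"
      using game_sound_blocks[OF _ _ le_refl] FO2mD[OF that] m by simp
    moreover have "?u \<in> K" "?v \<in> L" using uv unfolding K_def L_def by blast+
    ultimately show ?thesis unfolding separates_def by blast
  qed
  ultimately show ?thesis
    using sent by (intro exI[of _ "{..a}"] exI[of _ ?\<psi>] exI[of _ K] exI[of _ L]) simp
qed

end
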